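(* Let $\Omega$ be a $(K,\delta)$-dense sampling scheme and let $\mathcal T=\operatorname{span}\{\phi^{\mathrm{per}}_{R,k}\mathbb 1_{[0,1]}:k=0,\dots,2^R-1\}$ be the reconstruction space of dimension $2^R$ generated by a periodic wavelet basis. Suppose that either (i) the scaling function $\phi\in L^2(\mathbb R)$ and $\{\phi(\cdot-k)\}_{k\in\mathbb Z}$ is an orthonormal basis of $V_0$; or (ii) $\phi$ satisfies $|\hat\phi(\omega)|\le c(1+|\omega|)^{-\alpha}$ for all $\omega\in\mathbb R$, for some constant $c$ and some $\alpha>\tfrac12$, and $\{\phi(\cdot-k)\}_{k\in\mathbb Z}$ is a Riesz basis of $V_0$. Then for any $0<\epsilon<1-\delta$ there exists $c_0=c_0(\epsilon)$ such that if $K\ge c_0(\epsilon)2^R$ then $$C(\Omega,\mathcal T)\le\frac{1+\delta}{1-\delta-\epsilon}.$$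
   Context: For $f\in L^2(\mathbb R)$, $\hat f(\omega)=\int_{\mathbb R}f(x)e^{-2\pi i\omega x}\,dx$; $\langle\cdot,\cdot\rangle$, $\|\cdot\|$ denote the $L^2(\mathbb R)$ inner product and norm. $\mathcal H=\{f\in L^2(\mathbb R):\operatorname{supp}f\subseteq[0,1]\}$. $(K,\delta)$-density: for $K>0$, $0<\delta<1$, a finite set $\Omega=\{\omega_1<\dots<\omega_N\}\subset\mathbb R$ is $(K,\delta)$-dense if $\Omega\subseteq[-K,K]$ and $\max_{n=0,\dots,N}(\omega_{n+1}-\omega_n)\le\delta$, where $\omega_0=\omega_N-2K$, $\omega_{N+1}=\omega_1+2K$. Sampling operator: $\mathcal Sf(x)=\sum_{n=1}^N\mu_n\hat f(\omega_n)e^{2\pi i\omega_nx}\mathbb 1_{[0,1]}(x)$ with $\mu_n=\tfrac12(\omega_{n+1}-\omega_{n-1})$ (same convention for $\omega_0,\omega_{N+1}$). $C_1(\Omega,\mathcal T)=\inf_{0\ne f\in\mathcal T}\langle\mathcal Sf,f\rangle/\|f\|^2$, $C_2(\Omega)=\sup_{0\ne f\in\mathcal H}\langle\mathcal Sf,f\rangle/\|f\|^2$, and $C(\Omega,\mathcal T)=\sqrt{C_2(\Omega)/C_1(\Omega,\mathcal T)}$ (taken as $+\infty$ if $C_1=0$). Wavelets: a multiresolution analysis (MRA) generated by a scaling function $\phi\in L^2(\mathbb R)$ is a nested sequence of closed subspaces $\dots\subseteq V_{-1}\subseteq V_0\subseteq V_1\subseteq\dots$ of $L^2(\mathbb R)$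 with dense union and trivial intersection, $f(\cdot)\in V_j\iff f(2\cdot)\in V_{j+1}$, and $\{\phi(\cdot-k)\}_{k\in\mathbb Z}$ a Riesz basis of $V_0$ (i.e. there are $d_1,d_2>0$ with $d_1\sum|\alpha_k|^2\le\|\sum\alpha_k\phi(\cdot-k)\|^2\le d_2\sum|\alpha_k|^2$ for all $(\alpha_k)\in\ell^2(\mathbb Z)$). Throughout, $\phi$ is compactly supported with $\operatorname{supp}\phi\subseteq[-p+1,p]$ for some $p\in\mathbb N$. Set $\phi_{j,k}(x)=2^{j/2}\phi(2^jx-k)$, the periodization $f^{\mathrm{per}}(x)=\sum_{l\in\mathbb Z}f(x+l)$, and $\phi^{\mathrm{per}}_{j,k}=(\phi_{j,k})^{\mathrm{per}}$. (The space $\mathcal T$ equals $V^{\mathrm{per}}_J\oplus W^{\mathrm{per}}_J\oplus\dots\oplus W^{\mathrm{per}}_{R-1}$ for the periodized MRA.) *)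

theory Defs
  imports "HOL-Analysis.Analysis"
begin

definition sq_int :: "(real \<Rightarrow> complex) \<Rightarrow> bool" where
  "sq_int f \<longleftrightarrow> f \<in> borel_measurable lebesgue \<and>
                 integrable lebesgue (\<lambda>x. (cmod (f x))\<^sup>2)"

definition L2norm :: "(real \<Rightarrow> complex) \<Rightarrow> real" where
  "L2norm f = sqrt (integral\<^sup>L lebesgue (\<lambda>x. (cmod (f x))\<^sup>2))"

definition L2inner :: "(real \<Rightarrow> complex) \<Rightarrow> (real \<Rightarrow> complex) \<Rightarrow> complex" where
  "L2inner f g = integral\<^sup>L lebesgue (\<lambda>x. f x * cnj (g x))"

text \<open>Fourier transform  hat f(w) = int f(x) e^(-2 pi i w x) dx  (used only for
  functions that are square integrable and compactly supported, hence integrable).\<close>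
definition FT :: "(real \<Rightarrow> complex) \<Rightarrow> real \<Rightarrow> complex" where
  "FT f w = integral\<^sup>L lebesgue (\<lambda>x. f x * exp (- (2 * pi * \<i> * complex_of_real (w * x))))"

definition dil :: "(real \<Rightarrow> complex) \<Rightarrow> int \<Rightarrow> int \<Rightarrow> real \<Rightarrow> complex" where
  "dil \<phi> j k x = complex_of_real (2 powr (real_of_int j / 2)) * \<phi> (2 powr (real_of_int j) * x - real_of_int k)"

definition Vspace :: "(real \<Rightarrow> complex) \<Rightarrow> int \<Rightarrow> (real \<Rightarrow> complex) set" where
  "Vspace \<phi> j = {g. sq_int g \<and> (\<forall>e>0. \<exists>F c. finite F \<and>
        L2norm (\<lambda>x. g x - (\<Sum>k\<in>F. c k * dil \<phi> j k x)) < e)}"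

text \<open>Riesz basis inequalities for the integer translates (on finitely supported
  coefficient sequences, which is equivalent by density).\<close>
definition riesz_translates :: "(real \<Rightarrow> complex) \<Rightarrow> bool" where
  "riesz_translates \<phi> \<longleftrightarrow> (\<exists>d1 d2. 0 < d1 \<and> 0 < d2 \<and>
     (\<forall>F (a :: int \<Rightarrow> complex). finite F \<longrightarrow>
        d1 * (\<Sum>k\<in>F. (cmod (a k))\<^sup>2) \<le> (L2norm (\<lambda>x. \<Sum>k\<in>F. a k * \<phi> (x - real_of_int k)))\<^sup>2 \<and>
        (L2norm (\<lambda>x. \<Sum>k\<in>F. a k * \<phi> (x - real_of_int k)))\<^sup>2 \<le> d2 * (\<Sum>k\<in>F. (cmod (a k))\<^sup>2)))"

definition orthonormal_translates :: "(real \<Rightarrow> complex) \<Rightarrow> bool" where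
  "orthonormal_translates \<phi> \<longleftrightarrow>
     (\<forall>k l :: int. L2inner (\<lambda>x. \<phi> (x - real_of_int k)) (\<lambda>x. \<phi> (x - real_of_int l))
                   = (if k = l then 1 else 0))"

definition is_MRA :: "(real \<Rightarrow> complex) \<Rightarrow> bool" where
  "is_MRA \<phi> \<longleftrightarrow> sq_int \<phi> \<and>
     (\<forall>j. Vspace \<phi> j \<subseteq> Vspace \<phi> (j + 1)) \<and>
     (\<forall>f. sq_int f \<longrightarrow> (\<forall>e>0. \<exists>j g. g \<in> Vspace \<phi> j \<and> L2norm (\<lambda>x. f x - g x) < e)) \<and>
     (\<forall>f. (\<forall>j. f \<in> Vspace \<phi> j) \<longrightarrow> L2norm f = 0) \<and>
     (\<forall>f j. sq_int f \<longrightarrow> (f \<in> Vspace \<phi> j \<longleftrightarrow> (\<lambda>x. f (2 * x)) \<in> Vspace \<phi> (j + 1))) \<and>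
     riesz_translates \<phi>"

definition per :: "(real \<Rightarrow> complex) \<Rightarrow> real \<Rightarrow> complex" where
  "per f x = (\<Sum>\<^sub>\<infinity> l :: int. f (x + real_of_int l))"

definition Tspace :: "(real \<Rightarrow> complex) \<Rightarrow> nat \<Rightarrow> (real \<Rightarrow> complex) set" where
  "Tspace \<phi> R = {(\<lambda>x. (\<Sum>k<2^R. c k * per (dil \<phi> (int R) (int k)) x) * indicator {0..1} x)
                  | c :: nat \<Rightarrow> complex. True}"

definition Hspace :: "(real \<Rightarrow> complex) set" where
  "Hspace = {f. sq_int f \<and> (\<forall>x. x \<notin> {0..1} \<longrightarrow> f x = 0)}"

definition wext :: "real \<Rightarrow> nat \<Rightarrow> (nat \<Rightarrow> real) \<Rightarrow> nat \<Rightarrow> real" where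
  "wext K N w n = (if n = 0 then w N - 2 * K else if n = N + 1 then w 1 + 2 * K else w n)"

definition dense_scheme :: "real \<Rightarrow> real \<Rightarrow> nat \<Rightarrow> (nat \<Rightarrow> real) \<Rightarrow> bool" where
  "dense_scheme K \<delta> N w \<longleftrightarrow> 0 < K \<and> 0 < \<delta> \<and> \<delta> < 1 \<and> 1 \<le> N \<and>
     (\<forall>n\<in>{1..<N}. w n < w (n + 1)) \<and>
     (\<forall>n\<in>{1..N}. w n \<in> {-K..K}) \<and>
     (\<forall>n\<in>{0..N}. wext K N w (n + 1) - wext K N w n \<le> \<delta>)"

definition mu :: "real \<Rightarrow> nat \<Rightarrow> (nat \<Rightarrow> real) \<Rightarrow> nat \<Rightarrow> real" where
  "mu K N w n = (wext K N w (n + 1) - wext K N w (n - 1)) / 2"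

definition Sop :: "real \<Rightarrow> nat \<Rightarrow> (nat \<Rightarrow> real) \<Rightarrow> (real \<Rightarrow> complex) \<Rightarrow> real \<Rightarrow> complex" where
  "Sop K N w f x = (\<Sum>n=1..N. complex_of_real (mu K N w n) * FT f (w n)
        * exp (2 * pi * \<i> * complex_of_real (w n * x))) * indicator {0..1} x"

definition qform :: "real \<Rightarrow> nat \<Rightarrow> (nat \<Rightarrow> real) \<Rightarrow> (real \<Rightarrow> complex) \<Rightarrow> real" where
  "qform K N w f = Re (L2inner (Sop K N w f) f)"

definition C1 :: "real \<Rightarrow> nat \<Rightarrow> (nat \<Rightarrow> real) \<Rightarrow> (real \<Rightarrow> complex) set \<Rightarrow> ereal" where
  "C1 K N w T = (INF f\<in>{f\<in>T. L2norm f \<noteq> 0}. ereal (qform K N w f / (L2norm f)\<^sup>2))"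

definition C2 :: "real \<Rightarrow> nat \<Rightarrow> (nat \<Rightarrow> real) \<Rightarrow> ereal" where
  "C2 K N w = (SUP f\<in>{f\<in>Hspace. L2norm f \<noteq> 0}. ereal (qform K N w f / (L2norm f)\<^sup>2))"

definition Cconst :: "real \<Rightarrow> nat \<Rightarrow> (nat \<Rightarrow> real) \<Rightarrow> (real \<Rightarrow> complex) set \<Rightarrow> ereal" where
  "Cconst K N w T = (if C1 K N w T = 0 \<or> C2 K N w = \<infinity> then \<infinity>
                     else ereal (sqrt (real_of_ereal (C2 K N w / C1 K N w T))))"

end

theory Submission
  imports Defs "HOL-Probability.Probability"
begin

text \<open>
  Let \<open>z\<^sub>n\<close> be the midpoints of consecutive nodes. Then \<open>\<langle>Sf, f\<rangle> = \<Sum> \<mu>\<^sub>n |FT f (w\<^sub>n)|\<^sup>2\<close> is the squared norm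
  of the step function with value \<open>FT f (w\<^sub>n)\<close> on the cell \<open>[z\<^sub>n\<^sub>-\<^sub>1, z\<^sub>n]\<close>. After centring the support
  of \<open>f\<close> at \<open>0\<close>, the derivative of \<open>FT f\<close> has norm at most \<open>\<pi> \<parallel>f\<parallel>\<close>, and the sharp Wirtinger
  inequality on the half cells (of length at most \<open>\<delta>/2\<close>) bounds the distance between the step
  function and \<open>FT f\<close> by \<open>\<delta> \<parallel>f\<parallel>\<close>. This gives the upper bound \<open>(1 + \<delta>)\<^sup>2\<close>, and the lower bound
  \<open>(1 - \<delta> - \<epsilon>)\<^sup>2\<close> as soon as \<open>FT f\<close> carries a proportion \<open>1 - \<epsilon>\<close> of its energy on \<open>[-K + 1/2, K - 1/2]\<close>.

  For that concentration, average \<open>\<parallel>f - f(\<cdot> - s)\<parallel>\<^sup>2\<close> over a Gaussian in \<open>s\<close>: this controls the high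
  frequencies of \<open>f\<close>, so that it is enough to know that \<open>f \<in> T\<close> satisfies
  \<open>\<parallel>f - f(\<cdot> - s)\<parallel>\<^sup>2 \<le> (\<eta> + C (2\<^sup>R s)\<^sup>2) \<parallel>f\<parallel>\<^sup>2\<close> with \<open>C\<close> independent of \<open>R\<close>. After dilation by \<open>2\<^sup>R\<close> this
  follows from the local finiteness of the translates, continuity of translations in \<open>L\<^sup>2\<close>, and
  the lower Riesz bound transferred to one period.
\<close>

section \<open>Square integrable functions\<close>

abbreviation energy :: "(real \<Rightarrow> complex) \<Rightarrow> real" where
  "energy f \<equiv> integral\<^sup>L lebesgue (\<lambda>x. (cmod (f x))\<^sup>2)"

lemma L2norm_sq: "(L2norm f)\<^sup>2 = energy f"
  by (simp add: L2norm_def)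

lemma cmod_add_sq_le: "(cmod (a + b))\<^sup>2 \<le> 2 * (cmod a)\<^sup>2 + 2 * (cmod b)\<^sup>2"
proof -
  have "(cmod (a + b))\<^sup>2 \<le> (cmod a + cmod b)\<^sup>2"
    by (simp add: norm_triangle_ineq power_mono)
  also have "\<dots> \<le> 2 * (cmod a)\<^sup>2 + 2 * (cmod b)\<^sup>2"
    using sum_squares_bound[of "cmod a" "cmod b"] by (simp add: power2_sum)
  finally show ?thesis .
qed

lemma cmod_diff_sq_le: "(cmod (a - b))\<^sup>2 \<le> 2 * (cmod a)\<^sup>2 + 2 * (cmod b)\<^sup>2"
  using cmod_add_sq_le[of a "- b"] by simp

lemma sq_int_mono:
  assumes "sq_int f" "g \<in> borel_measurable lebesgue" "\<And>x. cmod (g x) \<le> C * cmod (f x)"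
  shows "sq_int g"
proof -
  have "integrable lebesgue (\<lambda>x. (cmod (g x))\<^sup>2)"
  proof (rule Bochner_Integration.integrable_bound)
    show "integrable lebesgue (\<lambda>x. C\<^sup>2 * (cmod (f x))\<^sup>2)"
      using assms(1) by (simp add: sq_int_def)
    show "(\<lambda>x. (cmod (g x))\<^sup>2) \<in> borel_measurable lebesgue"
      using assms(2) by measurable
    have "(cmod (g x))\<^sup>2 \<le> (C * cmod (f x))\<^sup>2" for x
      using assms(3) by (rule power_mono) simp
    then show "AE x in lebesgue. norm ((cmod (g x))\<^sup>2) \<le> norm (C\<^sup>2 * (cmod (f x))\<^sup>2)"
      by (simp add: power_mult_distrib)
  qed
  then show ?thesis using assms(2) by (simp add: sq_int_def)
qed

lemma sq_int_add: assumes "sq_int f" "sq_int g" shows "sq_int (\<lambda>x. f x + g x)"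
proof -
  have [measurable]: "f \<in> borel_measurable lebesgue" "g \<in> borel_measurable lebesgue"
    using assms by (simp_all add: sq_int_def)
  have "integrable lebesgue (\<lambda>x. (cmod (f x + g x))\<^sup>2)"
  proof (rule Bochner_Integration.integrable_bound)
    show "integrable lebesgue (\<lambda>x. 2 * (cmod (f x))\<^sup>2 + 2 * (cmod (g x))\<^sup>2)"
      using assms by (simp add: sq_int_def)
    show "(\<lambda>x. (cmod (f x + g x))\<^sup>2) \<in> borel_measurable lebesgue" by measurable
    show "AE x in lebesgue. norm ((cmod (f x + g x))\<^sup>2) \<le> norm (2 * (cmod (f x))\<^sup>2 + 2 * (cmod (g x))\<^sup>2)"
      using cmod_add_sq_le by simp
  qed
  then show ?thesis by (simp add: sq_int_def)
qed

lemma sq_int_cmult: "sq_int f \<Longrightarrow> sq_int (\<lambda>x. c * f x)"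
  by (auto simp: sq_int_def norm_mult power_mult_distrib)

lemma sq_int_diff: "sq_int f \<Longrightarrow> sq_int g \<Longrightarrow> sq_int (\<lambda>x. f x - g x)"
  using sq_int_add[of f "\<lambda>x. - 1 * g x"] sq_int_cmult[of g "- 1"] by simp

lemma sq_int_zero: "sq_int (\<lambda>x. 0)"
  by (simp add: sq_int_def)

lemma sq_int_sum: "(\<And>i. i \<in> I \<Longrightarrow> sq_int (f i)) \<Longrightarrow> sq_int (\<lambda>x. \<Sum>i\<in>I. f i x)"
  by (induction I rule: infinite_finite_induct) (auto intro: sq_int_add sq_int_zero)

lemma sq_int_indicator:
  assumes "sq_int f" "A \<in> sets lebesgue" shows "sq_int (\<lambda>x. f x * indicator A x)"
proof (rule sq_int_mono[OF assms(1), where C=1])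
  have [measurable]: "f \<in> borel_measurable lebesgue" using assms by (simp add: sq_int_def)
  show "(\<lambda>x. f x * indicator A x) \<in> borel_measurable lebesgue"
    using assms(2) by measurable
qed (auto simp: indicator_def)

lemma lebesgue_measurable_affine:
  fixes f :: "real \<Rightarrow> 'a::euclidean_space"
  assumes "f \<in> borel_measurable lebesgue" "c \<noteq> 0"
  shows "(\<lambda>x. f (t + c * x)) \<in> borel_measurable lebesgue"
proof -
  have "(\<lambda>x. t + c * x) \<in> lebesgue \<rightarrow>\<^sub>M lebesgue"
    using lebesgue_affine_measurable[where c= "\<lambda>x::real. c" and t=t] assms(2) by simp
  from measurable_compose[OF this assms(1)] show ?thesis by simp
qed

lemma sq_int_affine:
  assumes "sq_int f" "c \<noteq> 0" shows "sq_int (\<lambda>x. f (t + c * x))"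
proof -
  have "integrable lebesgue (\<lambda>x. (cmod (f (t + c * x)))\<^sup>2)"
    using lebesgue_integrable_real_affine_iff[OF assms(2), of "\<lambda>x. (cmod (f x))\<^sup>2" t] assms(1)
    by (simp add: sq_int_def)
  then show ?thesis
    using lebesgue_measurable_affine[of f c t] assms by (simp add: sq_int_def)
qed

lemma sq_int_shift: "sq_int f \<Longrightarrow> sq_int (\<lambda>x. f (x - s))"
  using sq_int_affine[of f 1 "- s"] by simp

lemma integral_lebesgue_shift:
  fixes f :: "real \<Rightarrow> real" shows "integral\<^sup>L lebesgue (\<lambda>x. f (x - s)) = integral\<^sup>L lebesgue f"
  using lebesgue_integral_real_affine[of 1 f "- s"] by simp

lemma energy_shift: "energy (\<lambda>x. f (x - s)) = energy f"
  by (rule integral_lebesgue_shift)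

lemma sq_int_integrable:
  assumes f: "sq_int f" and supp: "\<And>x. x \<notin> {A..B} \<Longrightarrow> f x = 0"
  shows "integrable lebesgue f"
proof (rule Bochner_Integration.integrable_bound)
  show "integrable lebesgue (\<lambda>x. (cmod (f x))\<^sup>2 + indicator {A..B} x :: real)"
    using f lmeasurable_interval(1)[of A B]
    by (intro Bochner_Integration.integrable_add) (auto simp: sq_int_def lmeasurable_iff_integrable)
  show "f \<in> borel_measurable lebesgue" using f by (simp add: sq_int_def)
  have "cmod (f x) \<le> (cmod (f x))\<^sup>2 + indicator {A..B} x" for x
  proof (cases "x \<in> {A..B}")
    case True
    have "2 * cmod (f x) * 1 \<le> (cmod (f x))\<^sup>2 + 1\<^sup>2" by (rule sum_squares_bound)
    then have "2 * cmod (f x) \<le> (cmod (f x))\<^sup>2 + 1" by simp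
    then show ?thesis using True norm_ge_zero[of "f x"] by (simp del: norm_ge_zero)
  qed (use supp in simp)
  then show "AE x in lebesgue. norm (f x) \<le> norm ((cmod (f x))\<^sup>2 + indicator {A..B} x)"
    by (auto intro!: AE_I2)
qed

lemma lebesgue_borel_representative:
  fixes f :: "real \<Rightarrow> complex"
  assumes f: "f \<in> borel_measurable lebesgue"
  obtains g where "g \<in> borel_measurable borel" "AE x in lborel. f x = g x"
proof -
  have "(\<lambda>x. Re (f x)) \<in> borel_measurable lebesgue" "(\<lambda>x. Im (f x)) \<in> borel_measurable lebesgue"
    using f by measurable
  from this[THEN completion_ex_borel_measurable_real]
  obtain u v where uv: "u \<in> borel_measurable lborel" "v \<in> borel_measurable lborel"
    "AE x in lborel. Re (f x) = u x" "AE x in lborel. Im (f x) = v x" by auto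
  let ?g = "\<lambda>x. Complex (u x) (v x)"
  have "?g = (\<lambda>x. complex_of_real (u x) + \<i> * complex_of_real (v x))"
    by (auto simp: Complex_eq)
  then have "?g \<in> borel_measurable borel" using uv(1,2) by simp
  moreover have "AE x in lborel. f x = ?g x" using uv(3,4)
    by eventually_elim (auto simp: complex_eq_iff)
  ultimately show thesis by (rule that)
qed

lemma AE_lborel_shift:
  assumes "AE x in lborel. P (x::real)" shows "AE x in lborel. P (x - s)"
proof -
  obtain N where N: "N \<in> null_sets lborel" "{x. \<not> P x} \<subseteq> N"
    using assms by (auto simp: eventually_ae_filter)
  have "N \<in> null_sets lebesgue" using N(1) by (rule null_sets_completionI)
  then have "negligible N" by (simp add: negligible_iff_null_sets)
  then have "negligible ((+) s ` N)" by (rule negligible_translation)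
  then have "(+) s ` N \<in> null_sets lebesgue" by (simp add: negligible_iff_null_sets)
  moreover have "{x \<in> space lebesgue. \<not> P (x - s)} \<subseteq> (+) s ` N"
    using N(2) by (auto simp: image_iff) (smt (verit) mem_Collect_eq subsetD)
  ultimately have "AE x in lebesgue. P (x - s)"
    unfolding eventually_ae_filter by blast
  then show ?thesis by (simp add: AE_completion_iff)
qed

section \<open>Continuity of translations\<close>

definition clamp_disc :: "real \<Rightarrow> complex \<Rightarrow> complex" where
  "clamp_disc B z = z / complex_of_real (max 1 (cmod z / B))"

lemma clamp_disc_bounds:
  assumes "B > 0"
  shows "cmod (clamp_disc B z) \<le> B" "cmod (clamp_disc B z) \<le> cmod z" "cmod (z - clamp_disc B z) \<le> cmod z"
    and "cmod z \<le> B \<Longrightarrow> clamp_disc B z = z"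
proof -
  define m where "m = max 1 (cmod z / B)"
  have m: "m \<ge> 1" "cmod z / B \<le> m" by (auto simp: m_def)
  have eq: "clamp_disc B z = z / complex_of_real m" by (simp add: clamp_disc_def m_def)
  have n: "cmod (clamp_disc B z) = cmod z / m" unfolding eq using m(1) by (simp add: norm_divide)
  show "cmod (clamp_disc B z) \<le> B" unfolding n using m assms by (simp add: field_simps)
  show "cmod (clamp_disc B z) \<le> cmod z" unfolding n using m(1) by (simp add: divide_le_eq mult_right_le_one_le mult_le_cancel_left1)
  have "z - clamp_disc B z = complex_of_real (1 - 1 / m) * z" unfolding eq by (simp add: field_simps)
  then have "cmod (z - clamp_disc B z) = \<bar>1 - 1 / m\<bar> * cmod z" by (simp only: norm_mult norm_of_real)
  also have "\<dots> \<le> 1 * cmod z" using m(1) by (intro mult_right_mono) (auto simp: abs_if divide_le_eq)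
  finally show "cmod (z - clamp_disc B z) \<le> cmod z" by simp
  show "clamp_disc B z = z" if "cmod z \<le> B"
    using that assms by (simp add: clamp_disc_def max_def divide_le_eq)
qed

lemma continuous_on_clamp_disc: "B > 0 \<Longrightarrow> continuous_on S (clamp_disc B)"
  unfolding clamp_disc_def[abs_def] by (intro continuous_intros) auto

lemma energy_tendsto_zero:
  fixes F :: "nat \<Rightarrow> real \<Rightarrow> complex"
  assumes m: "\<And>n. F n \<in> borel_measurable lebesgue" and w: "integrable lebesgue w"
    and b: "\<And>n x. (cmod (F n x))\<^sup>2 \<le> w x"
    and l: "AE x in lebesgue. (\<lambda>n. F n x) \<longlonglongrightarrow> 0"
  shows "(\<lambda>n. energy (F n)) \<longlonglongrightarrow> 0"
proof -
  have "(\<lambda>n. energy (F n)) \<longlonglongrightarrow> integral\<^sup>L lebesgue (\<lambda>x::real. 0::real)"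
  proof (rule Bochner_Integration.integral_dominated_convergence[where w=w])
    show "(\<lambda>x. (cmod (F n x))\<^sup>2) \<in> borel_measurable lebesgue" for n
      using m[of n] by measurable
    show "AE x in lebesgue. (\<lambda>n. (cmod (F n x))\<^sup>2) \<longlonglongrightarrow> 0"
      using l by eventually_elim (auto intro!: tendsto_eq_intros)
    show "integrable lebesgue w" by (rule w)
    show "AE x in lebesgue. norm ((cmod (F n x))\<^sup>2) \<le> w x" for n
      using b by simp
  qed simp
  then show ?thesis by simp
qed

lemma L2_approx_continuous:
  assumes f: "sq_int f" and e: "e > 0"
  obtains g where "continuous_on UNIV g" "energy (\<lambda>x. (f x - g x) * indicator {-a..a} x) < e"
proof -
  have fm: "f \<in> borel_measurable lebesgue" and f2: "integrable lebesgue (\<lambda>x. (cmod (f x))\<^sup>2)"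
    using f by (simp_all add: sq_int_def)
  have clm: "(\<lambda>x. clamp_disc (real (Suc n)) (f x)) \<in> borel_measurable lebesgue" for n
    using measurable_compose[OF fm borel_measurable_continuous_onI[OF continuous_on_clamp_disc[of "real (Suc n)" UNIV]]]
    by simp
  have "(\<lambda>n. energy (\<lambda>x. f x - clamp_disc (real (Suc n)) (f x))) \<longlonglongrightarrow> 0"
  proof (rule energy_tendsto_zero[OF _ f2])
    show "(\<lambda>x. f x - clamp_disc (real (Suc n)) (f x)) \<in> borel_measurable lebesgue" for n
      using fm clm[of n] by (rule borel_measurable_diff)
    show "(cmod (f x - clamp_disc (real (Suc n)) (f x)))\<^sup>2 \<le> (cmod (f x))\<^sup>2" for n x
      by (intro power_mono clamp_disc_bounds) auto
    have "(\<lambda>n. f x - clamp_disc (real (Suc n)) (f x)) \<longlonglongrightarrow> 0" for x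
    proof (rule tendsto_eventually)
      obtain n0 where "cmod (f x) \<le> real n0" using real_arch_simple by blast
      then have "\<forall>n\<ge>n0. f x - clamp_disc (real (Suc n)) (f x) = 0"
        by (auto simp: clamp_disc_bounds(4))
      then show "\<forall>\<^sub>F n in sequentially. f x - clamp_disc (real (Suc n)) (f x) = 0"
        unfolding eventually_sequentially by blast
    qed
    then show "AE x in lebesgue. (\<lambda>n. f x - clamp_disc (real (Suc n)) (f x)) \<longlonglongrightarrow> 0" by simp
  qed
  then have "\<forall>\<^sub>F n in sequentially. energy (\<lambda>x. f x - clamp_disc (real (Suc n)) (f x)) < e / 4"
    using e by (intro order_tendstoD) auto
  then obtain n1 where n1: "energy (\<lambda>x. f x - clamp_disc (real (Suc n1)) (f x)) < e / 4"
    by (auto simp: eventually_sequentially)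
  define B where "B = real (Suc n1)"
  have B: "B > 0" by (simp add: B_def)
  define c where "c = clamp_disc B"
  have cm: "(\<lambda>x. c (f x)) \<in> borel_measurable lebesgue" using clm[of n1] by (simp add: c_def B_def)
  have "f measurable_on UNIV" using fm by (simp add: measurable_on_iff_borel_measurable)
  then obtain N g where N: "negligible N" and g: "\<And>n. continuous_on UNIV (g n)"
    and lim: "\<And>x. x \<notin> N \<Longrightarrow> (\<lambda>n. g n x) \<longlonglongrightarrow> f x"
    unfolding measurable_on_def by auto
  have cg: "continuous_on UNIV (\<lambda>x. c (g n x))" for n
    unfolding c_def by (rule continuous_on_compose2[OF continuous_on_clamp_disc[OF B, of UNIV] g]) simp
  have ind: "(\<lambda>x. indicator {-a..a} x :: complex) \<in> borel_measurable lebesgue"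
    by (intro measurable_completion) simp
  have "(\<lambda>n. energy (\<lambda>x. (c (f x) - c (g n x)) * indicator {-a..a} x)) \<longlonglongrightarrow> 0"
  proof (rule energy_tendsto_zero)
    show "(\<lambda>x. (c (f x) - c (g n x)) * indicator {-a..a} x) \<in> borel_measurable lebesgue" for n
      by (intro borel_measurable_times borel_measurable_diff cm ind measurable_completion)
        (simp add: borel_measurable_continuous_onI[OF cg])
    show "integrable lebesgue (\<lambda>x. (2 * B)\<^sup>2 * indicator {-a..a} x)"
      using lmeasurable_interval(1)[of "-a" a] by (intro integrable_mult_right) (simp add: lmeasurable_iff_integrable)
    show "(cmod ((c (f x) - c (g n x)) * indicator {-a..a} x))\<^sup>2 \<le> (2 * B)\<^sup>2 * indicator {-a..a} x" for n x
    proof -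
      have "cmod (c (f x) - c (g n x)) \<le> cmod (c (f x)) + cmod (c (g n x))" by (rule norm_triangle_ineq4)
      also have "\<dots> \<le> 2 * B" using clamp_disc_bounds(1)[OF B] unfolding c_def by (smt (verit))
      finally have "(cmod (c (f x) - c (g n x)))\<^sup>2 \<le> (2 * B)\<^sup>2" by (intro power_mono) auto
      then show ?thesis by (auto simp: indicator_def)
    qed
    have "AE x in lebesgue. x \<notin> N" using N by (intro AE_not_in) (simp add: negligible_iff_null_sets)
    then show "AE x in lebesgue. (\<lambda>n. (c (f x) - c (g n x)) * indicator {-a..a} x) \<longlonglongrightarrow> 0"
    proof eventually_elim
      case (elim x)
      have "isCont c (f x)"
        using continuous_on_clamp_disc[OF B, of UNIV] by (simp add: c_def continuous_on_eq_continuous_at)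
      then have "(\<lambda>n. c (g n x)) \<longlonglongrightarrow> c (f x)" by (rule isCont_tendsto_compose[OF _ lim[OF elim]])
      then show ?case by (auto intro!: tendsto_eq_intros)
    qed
  qed
  then have "\<forall>\<^sub>F n in sequentially. energy (\<lambda>x. (c (f x) - c (g n x)) * indicator {-a..a} x) < e / 4"
    using e by (intro order_tendstoD) auto
  then obtain n2 where n2: "energy (\<lambda>x. (c (f x) - c (g n2 x)) * indicator {-a..a} x) < e / 4"
    by (auto simp: eventually_sequentially)
  define k where "k x = c (g n2 x)" for x
  have ck: "continuous_on UNIV k" using cg[of n2] by (simp add: k_def[abs_def])
  have s1: "sq_int (\<lambda>x. f x - c (f x))"
    by (rule sq_int_mono[OF f, where C=1])
      (use fm cm clamp_disc_bounds(3)[OF B] in \<open>auto simp: c_def\<close>)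
  have s2: "sq_int (\<lambda>x. (c (f x) - k x) * indicator {-a..a} x)"
  proof -
    have "(\<lambda>x. (c (f x) - k x) * indicator {-a..a} x) \<in> borel_measurable lebesgue"
      by (intro borel_measurable_times borel_measurable_diff cm ind measurable_completion)
        (simp add: borel_measurable_continuous_onI[OF ck])
    moreover have "integrable lebesgue (\<lambda>x. (cmod ((c (f x) - k x) * indicator {-a..a} x))\<^sup>2)"
    proof (rule Bochner_Integration.integrable_bound)
      show "integrable lebesgue (\<lambda>x. (2 * B)\<^sup>2 * indicator {-a..a} x)"
        using lmeasurable_interval(1)[of "-a" a] by (intro integrable_mult_right) (simp add: lmeasurable_iff_integrable)
      show "(\<lambda>x. (cmod ((c (f x) - k x) * indicator {-a..a} x))\<^sup>2) \<in> borel_measurable lebesgue"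
        using calculation by measurable
      have "(cmod (c (f x) - k x))\<^sup>2 \<le> (2 * B)\<^sup>2" for x
      proof (intro power_mono)
        have "cmod (c (f x) - k x) \<le> cmod (c (f x)) + cmod (k x)" by (rule norm_triangle_ineq4)
        also have "\<dots> \<le> 2 * B" using clamp_disc_bounds(1)[OF B] unfolding c_def k_def by (smt (verit))
        finally show "cmod (c (f x) - k x) \<le> 2 * B" .
      qed simp
      then show "AE x in lebesgue. norm ((cmod ((c (f x) - k x) * indicator {-a..a} x))\<^sup>2) \<le> norm ((2 * B)\<^sup>2 * indicator {-a..a} x :: real)"
        by (auto simp: indicator_def)
    qed
    ultimately show ?thesis by (simp add: sq_int_def)
  qed
  have "energy (\<lambda>x. (f x - k x) * indicator {-a..a} x)
      \<le> (LINT x|lebesgue. 2 * (cmod (f x - c (f x)))\<^sup>2 + 2 * (cmod ((c (f x) - k x) * indicator {-a..a} x))\<^sup>2)"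
  proof (rule integral_mono')
    show "integrable lebesgue (\<lambda>x. 2 * (cmod (f x - c (f x)))\<^sup>2 + 2 * (cmod ((c (f x) - k x) * indicator {-a..a} x))\<^sup>2)"
      using s1 s2 by (simp add: sq_int_def)
    show "(cmod ((f x - k x) * indicator {-a..a} x))\<^sup>2
       \<le> 2 * (cmod (f x - c (f x)))\<^sup>2 + 2 * (cmod ((c (f x) - k x) * indicator {-a..a} x))\<^sup>2" for x
      using cmod_add_sq_le[of "f x - c (f x)" "c (f x) - k x"] by (auto simp: indicator_def)
  qed simp
  also have "\<dots> = 2 * energy (\<lambda>x. f x - c (f x)) + 2 * energy (\<lambda>x. (c (f x) - k x) * indicator {-a..a} x)"
    using s1 s2 by (simp add: sq_int_def)
  also have "\<dots> < e" using n1 n2 by (simp add: c_def B_def k_def)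
  finally show thesis using that[OF ck] by blast
qed

lemma translation_continuous:
  assumes f: "sq_int f" and supp: "\<And>x. x \<notin> {-a..a} \<Longrightarrow> f x = 0" and a: "0 \<le> a" and e: "e > 0"
  obtains d where "0 < d" "d \<le> 1" "\<And>s. \<bar>s\<bar> < d \<Longrightarrow> energy (\<lambda>x. f x - f (x - s)) \<le> e"
proof -
  obtain g where g: "continuous_on UNIV g" and ge: "energy (\<lambda>x. (f x - g x) * indicator {-(a + 2)..a + 2} x) < e / 16"
    using L2_approx_continuous[OF f, of "e / 16" "a + 2"] e by auto
  define D where "D x = (f x - g x) * indicator {-(a + 2)..a + 2} x" for x
  have gI: "sq_int (\<lambda>x. g x * indicator {-(a + 2)..a + 2} x)"
  proof -
    have m: "(\<lambda>x. g x * indicator {-(a + 2)..a + 2} x) \<in> borel_measurable borel"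
      by (intro borel_measurable_times borel_measurable_continuous_onI[OF g]) simp
    have "integrable lborel (\<lambda>x. (cmod (g x))\<^sup>2 * indicator {-(a + 2)..a + 2} x)"
    proof -
      have "continuous_on {-(a + 2)..a + 2} (\<lambda>x. (cmod (g x))\<^sup>2)"
        by (intro continuous_intros continuous_on_subset[OF g]) simp
      from borel_integrable_atLeastAtMost'[OF this] show ?thesis
        by (simp add: set_integrable_def mult.commute)
    qed
    moreover have "(\<lambda>x. (cmod (g x))\<^sup>2 * indicator {-(a + 2)..a + 2} x) = (\<lambda>x. (cmod (g x * indicator {-(a + 2)..a + 2} x))\<^sup>2)"
      by (auto simp: indicator_def)
    ultimately have "integrable lebesgue (\<lambda>x. (cmod (g x * indicator {-(a + 2)..a + 2} x))\<^sup>2)"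
      using m by (simp add: integrable_completion)
    then show ?thesis using measurable_completion[of _ lborel] m by (auto simp: sq_int_def)
  qed
  have D: "sq_int D"
  proof -
    have "sq_int (\<lambda>x. f x * indicator {-(a + 2)..a + 2} x - g x * indicator {-(a + 2)..a + 2} x)"
      by (intro sq_int_diff sq_int_indicator f gI) simp
    then show ?thesis by (simp add: D_def[abs_def] left_diff_distrib)
  qed
  have "uniformly_continuous_on {-(a + 2)..a + 2} g"
    by (intro compact_uniformly_continuous continuous_on_subset[OF g]) auto
  moreover define q where "q = sqrt (e / (8 * (2 * a + 2)))"
  have q: "q > 0" using a e by (simp add: q_def)
  ultimately obtain d where d: "d > 0" "\<And>x y. \<lbrakk>x \<in> {-(a + 2)..a + 2}; y \<in> {-(a + 2)..a + 2}; dist y x < d\<rbrakk> \<Longrightarrow> dist (g y) (g x) < q"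
    unfolding uniformly_continuous_on_def by metis
  have "energy (\<lambda>x. f x - f (x - s)) \<le> e" if s: "\<bar>s\<bar> < min d 1" for s
  proof -
    let ?R = "\<lambda>x. 4 * (cmod (D x))\<^sup>2 + 4 * (cmod (D (x - s)))\<^sup>2 + 2 * (q\<^sup>2 * indicator {-(a + 1)..a + 1} x)"
    have i: "integrable lebesgue (\<lambda>x. q\<^sup>2 * indicator {-(a + 1)..a + 1} x)"
      using lmeasurable_interval(1)[of "-(a+1)" "a+1"] by (intro integrable_mult_right) (simp add: lmeasurable_iff_integrable)
    have iD: "integrable lebesgue (\<lambda>x. (cmod (D x))\<^sup>2)" "integrable lebesgue (\<lambda>x. (cmod (D (x - s)))\<^sup>2)"
      using D sq_int_shift[OF D, of s] by (simp_all add: sq_int_def)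
    have "energy (\<lambda>x. f x - f (x - s)) \<le> integral\<^sup>L lebesgue ?R"
    proof (rule integral_mono')
      show "integrable lebesgue ?R"
        by (intro Bochner_Integration.integrable_add integrable_mult_right i iD)
      fix x
      show "(cmod (f x - f (x - s)))\<^sup>2 \<le> ?R x"
      proof (cases "x \<in> {-(a + 1)..a + 1}")
        case True
        then have I: "x \<in> {-(a + 2)..a + 2}" "x - s \<in> {-(a + 2)..a + 2}" using s by auto
        have "dist x (x - s) < d" using s by (simp add: dist_real_def)
        then have "cmod (g x - g (x - s)) < q" using d(2)[OF I(2,1)] by (simp add: dist_norm)
        then have gq: "(cmod (g x - g (x - s)))\<^sup>2 \<le> q\<^sup>2" by (intro power_mono) auto
        have "f x - f (x - s) = (D x - D (x - s)) + (g x - g (x - s))" using I by (simp add: D_def)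
        then have "(cmod (f x - f (x - s)))\<^sup>2 \<le> 2 * (cmod (D x - D (x - s)))\<^sup>2 + 2 * (cmod (g x - g (x - s)))\<^sup>2"
          using cmod_add_sq_le by metis
        then show ?thesis using cmod_diff_sq_le[of "D x" "D (x - s)"] gq True by simp
      next
        case False
        then have "x \<notin> {-a..a}" "x - s \<notin> {-a..a}" using s by auto
        then show ?thesis using supp False by simp
      qed
    qed simp
    also have "\<dots> = 4 * energy D + 4 * energy D + 2 * (q\<^sup>2 * (2 * a + 2))"
      using iD i a by (simp add: energy_shift)
    also have "\<dots> \<le> e"
    proof -
      have "q\<^sup>2 * (2 * a + 2) = e / 8" using a e by (simp add: q_def field_simps)
      then show ?thesis using ge a e unfolding D_def[abs_def] by linarith
    qed
    finally show ?thesis .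
  qed
  then show thesis using that[of "min d 1"] d(1) by simp
qed

section \<open>Finite sums of translates on a window\<close>

lemma cmod_sum_sq_le_card:
  assumes "finite F"
  shows "(cmod (\<Sum>k\<in>F. z k))\<^sup>2 \<le> real (card F) * (\<Sum>k\<in>F. (cmod (z k))\<^sup>2)"
proof -
  have "(cmod (\<Sum>k\<in>F. z k))\<^sup>2 \<le> (\<Sum>k\<in>F. cmod (z k))\<^sup>2"
    by (intro power_mono norm_sum) simp
  also have "\<dots> \<le> (\<Sum>k\<in>F. (cmod (z k))\<^sup>2) * real (card F)"
    by (rule sum_squared_le_sum_of_squares)
  finally show ?thesis by (simp add: mult.commute)
qed

lemma energy_locally_finite_sum:
  fixes D :: "int \<Rightarrow> real \<Rightarrow> complex" and p :: nat
  assumes F: "finite F" and D: "\<And>k. k \<in> F \<Longrightarrow> sq_int (D k)"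
    and supp: "\<And>k x. k \<in> F \<Longrightarrow> x - real_of_int k \<notin> {- real p..real p + 1} \<Longrightarrow> D k x = 0"
  shows "energy (\<lambda>x. \<Sum>k\<in>F. D k x) \<le> (2 * real p + 2) * (\<Sum>k\<in>F. energy (D k))"
proof -
  have "energy (\<lambda>x. \<Sum>k\<in>F. D k x) \<le> (LINT x|lebesgue. (2 * real p + 2) * (\<Sum>k\<in>F. (cmod (D k x))\<^sup>2))"
  proof (rule integral_mono')
    show "integrable lebesgue (\<lambda>x. (2 * real p + 2) * (\<Sum>k\<in>F. (cmod (D k x))\<^sup>2))"
      using D by (intro integrable_mult_right Bochner_Integration.integrable_sum) (simp add: sq_int_def)
    fix x
    define G where "G = {k \<in> F. D k x \<noteq> 0}"
    have "G \<subseteq> {\<lceil>x\<rceil> - int p - 1..\<lfloor>x\<rfloor> + int p}"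
    proof
      fix k assume "k \<in> G"
      then have "x - real_of_int k \<in> {- real p..real p + 1}" using supp by (auto simp: G_def)
      then have "x \<le> real_of_int (k + int p + 1)" "real_of_int (k - int p) \<le> x" by auto
      then have "\<lceil>x\<rceil> \<le> k + int p + 1" "k - int p \<le> \<lfloor>x\<rfloor>" by (simp_all only: ceiling_le le_floor_iff)
      then show "k \<in> {\<lceil>x\<rceil> - int p - 1..\<lfloor>x\<rfloor> + int p}" by auto
    qed
    then have "card G \<le> card {\<lceil>x\<rceil> - int p - 1..\<lfloor>x\<rfloor> + int p}" by (intro card_mono) auto
    also have "\<dots> \<le> 2 * p + 2" using floor_le_ceiling[of x] by (simp add: nat_le_iff)
    finally have cG: "real (card G) \<le> 2 * real p + 2" by linarith
    have "(\<Sum>k\<in>F. D k x) = (\<Sum>k\<in>G. D k x)"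
      using F by (intro sum.mono_neutral_right) (auto simp: G_def)
    then have "(cmod (\<Sum>k\<in>F. D k x))\<^sup>2 \<le> real (card G) * (\<Sum>k\<in>G. (cmod (D k x))\<^sup>2)"
      using cmod_sum_sq_le_card[of G "\<lambda>k. D k x"] F by (simp add: G_def)
    also have "\<dots> \<le> (2 * real p + 2) * (\<Sum>k\<in>F. (cmod (D k x))\<^sup>2)"
      using F cG by (intro mult_mono sum_mono2) (auto simp: G_def intro: sum_nonneg)
    finally show "(cmod (\<Sum>k\<in>F. D k x))\<^sup>2 \<le> (2 * real p + 2) * (\<Sum>k\<in>F. (cmod (D k x))\<^sup>2)" .
    show "0 \<le> (2 * real p + 2) * (\<Sum>k\<in>F. (cmod (D k x))\<^sup>2)" by (intro mult_nonneg_nonneg sum_nonneg) auto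
  qed
  also have "\<dots> = (2 * real p + 2) * (\<Sum>k\<in>F. energy (D k))"
    using D by (subst integral_mult_right_zero, subst Bochner_Integration.integral_sum) (auto simp: sq_int_def)
  finally show ?thesis .
qed

definition window_sum :: "(real \<Rightarrow> complex) \<Rightarrow> int set \<Rightarrow> nat \<Rightarrow> (int \<Rightarrow> complex) \<Rightarrow> real \<Rightarrow> complex" where
  "window_sum \<phi> F M a x = (\<Sum>k\<in>F. a k * \<phi> (x - real_of_int k)) * indicator {0..real M} x"

lemma sq_int_window_sum: "sq_int \<phi> \<Longrightarrow> sq_int (window_sum \<phi> F M a)"
  unfolding window_sum_def[abs_def]
  by (intro sq_int_indicator sq_int_sum sq_int_cmult sq_int_shift) auto

text \<open>
  Cutting a translate \<open>\<phi>(\<cdot> - k)\<close> at the ends of the window amounts to truncating \<open>\<phi>\<close> to an interval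
  with integer endpoints, which may be clamped to \<open>{-p..p + 1}\<close>. Only finitely many truncations
  occur, so one modulus of continuity serves all \<open>k\<close> and all window lengths.
\<close>

lemma truncated_translates_continuous:
  fixes p :: nat
  assumes phi: "sq_int \<phi>" and supp: "\<And>x. x \<notin> {- real p + 1..real p} \<Longrightarrow> \<phi> x = 0" and e: "e > 0"
  obtains d where "0 < d" "d \<le> 1"
    "\<And>i j s. \<lbrakk>i \<in> {- int p..int p + 1}; j \<in> {- int p..int p + 1}; \<bar>s\<bar> < d\<rbrakk> \<Longrightarrow>
       energy (\<lambda>x. \<phi> x * indicator {real_of_int i..real_of_int j} x
         - \<phi> (x - s) * indicator {real_of_int i..real_of_int j} (x - s)) \<le> e"
proof -
  let ?I = "{- int p..int p + 1} \<times> {- int p..int p + 1}"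
  let ?f = "\<lambda>ij x. \<phi> x * indicator {real_of_int (fst ij)..real_of_int (snd ij)} x"
  have "\<forall>ij. \<exists>d. 0 < d \<and> d \<le> 1 \<and> (\<forall>s. \<bar>s\<bar> < d \<longrightarrow> energy (\<lambda>x. ?f ij x - ?f ij (x - s)) \<le> e)"
  proof
    fix ij
    have sq: "sq_int (?f ij)" by (intro sq_int_indicator phi) simp
    have z: "?f ij x = 0" if "x \<notin> {- real p..real p}" for x
      using supp[of x] that by auto
    obtain d where "0 < d" "d \<le> 1" "\<And>s. \<bar>s\<bar> < d \<Longrightarrow> energy (\<lambda>x. ?f ij x - ?f ij (x - s)) \<le> e"
      using translation_continuous[OF sq z of_nat_0_le_iff e] by blast
    then show "\<exists>d. 0 < d \<and> d \<le> 1 \<and> (\<forall>s. \<bar>s\<bar> < d \<longrightarrow> energy (\<lambda>x. ?f ij x - ?f ij (x - s)) \<le> e)"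
      by blast
  qed
  from choice[OF this] obtain d where d: "\<And>ij. 0 < d ij" "\<And>ij. d ij \<le> 1"
    "\<And>ij s. \<bar>s\<bar> < d ij \<Longrightarrow> energy (\<lambda>x. ?f ij x - ?f ij (x - s)) \<le> e" by blast
  have ne: "?I \<noteq> {}" "finite ?I" by auto
  have "(0, 0) \<in> ?I" by simp
  then have "Min (d ` ?I) \<le> 1" using ne(2) d(2)[of "(0, 0)"] by (meson Min_le finite_imageI imageI order_trans)
  moreover have "Min (d ` ?I) > 0" using ne d(1) by (subst Min_gr_iff) auto
  moreover have "energy (\<lambda>x. \<phi> x * indicator {real_of_int i..real_of_int j} x
         - \<phi> (x - s) * indicator {real_of_int i..real_of_int j} (x - s)) \<le> e"
    if "i \<in> {- int p..int p + 1}" "j \<in> {- int p..int p + 1}" "\<bar>s\<bar> < Min (d ` ?I)" for i j s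
  proof -
    have "\<bar>s\<bar> < d (i, j)" using that(3) ne that(1,2) by (subst (asm) Min_gr_iff) auto
    from d(3)[OF this] show ?thesis by simp
  qed
  ultimately show thesis using that by blast
qed

lemma window_sum_translation:
  fixes p :: nat
  assumes phi: "sq_int \<phi>" and supp: "\<And>x. x \<notin> {- real p + 1..real p} \<Longrightarrow> \<phi> x = 0" and e: "e > 0"
  obtains d where "0 < d"
    "\<And>M F a s. \<lbrakk>finite F; \<bar>s\<bar> < d\<rbrakk> \<Longrightarrow>
       energy (\<lambda>x. window_sum \<phi> F M a x - window_sum \<phi> F M a (x - s)) \<le> e * (\<Sum>k\<in>F. (cmod (a k))\<^sup>2)"
proof -
  define e' where "e' = e / (2 * real p + 2)"
  have e': "e' > 0" "(2 * real p + 2) * e' = e" using e by (simp_all add: e'_def add_pos_nonneg)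
  obtain d where d: "0 < d" "d \<le> 1"
    "\<And>i j s. \<lbrakk>i \<in> {- int p..int p + 1}; j \<in> {- int p..int p + 1}; \<bar>s\<bar> < d\<rbrakk> \<Longrightarrow>
       energy (\<lambda>x. \<phi> x * indicator {real_of_int i..real_of_int j} x
         - \<phi> (x - s) * indicator {real_of_int i..real_of_int j} (x - s)) \<le> e'"
    using truncated_translates_continuous[OF phi supp e'(1)] by blast
  have "energy (\<lambda>x. window_sum \<phi> F M a x - window_sum \<phi> F M a (x - s)) \<le> e * (\<Sum>k\<in>F. (cmod (a k))\<^sup>2)"
    if F: "finite F" and s: "\<bar>s\<bar> < d" for M F a s
  proof -
    define cl where "cl c = max (- int p) (min (int p + 1) c)" for c
    define \<psi> where "\<psi> k x = \<phi> x * indicator {real_of_int (cl (- k))..real_of_int (cl (int M - k))} x" for k x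
    have cl: "cl c \<in> {- int p..int p + 1}" for c by (auto simp: cl_def)
    have trunc: "\<phi> (x - real_of_int k) * indicator {0..real M} x = \<psi> k (x - real_of_int k)" for k x
    proof (cases "\<phi> (x - real_of_int k) = 0")
      case False
      then have "- real p + 1 \<le> x - real_of_int k" "x - real_of_int k \<le> real p" using supp by force+
      then have "x \<in> {0..real M} \<longleftrightarrow> x - real_of_int k \<in> {real_of_int (cl (- k))..real_of_int (cl (int M - k))}"
        unfolding cl_def by (auto simp: max_def min_def)
      then show ?thesis by (simp add: \<psi>_def indicator_def)
    qed (simp add: \<psi>_def)
    define D where "D k x = a k * (\<psi> k (x - real_of_int k) - \<psi> k (x - real_of_int k - s))" for k x
    have ps: "sq_int (\<psi> k)" for k unfolding \<psi>_def[abs_def] by (intro sq_int_indicator phi) simp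
    have pd: "sq_int (\<lambda>x. \<psi> k x - \<psi> k (x - s))" for k by (intro sq_int_diff sq_int_shift ps)
    have D: "sq_int (D k)" for k
      unfolding D_def[abs_def] using sq_int_shift[OF pd, of k "real_of_int k"] by (intro sq_int_cmult) simp
    have eD: "energy (D k) \<le> (cmod (a k))\<^sup>2 * e'" for k
    proof -
      have "energy (D k) = (cmod (a k))\<^sup>2 * energy (\<lambda>x. \<psi> k (x - real_of_int k) - \<psi> k (x - real_of_int k - s))"
        unfolding D_def[abs_def] by (simp add: norm_mult power_mult_distrib)
      also have "energy (\<lambda>x. \<psi> k (x - real_of_int k) - \<psi> k (x - real_of_int k - s)) = energy (\<lambda>x. \<psi> k x - \<psi> k (x - s))"
        by (rule energy_shift)
      also have "\<dots> \<le> e'" unfolding \<psi>_def by (rule d(3)[OF cl cl s])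
      finally show ?thesis by (simp add: mult_left_mono)
    qed
    have "window_sum \<phi> F M a x - window_sum \<phi> F M a (x - s) = (\<Sum>k\<in>F. D k x)" for x
    proof -
      have W: "window_sum \<phi> F M a y = (\<Sum>k\<in>F. a k * \<psi> k (y - real_of_int k))" for y
        unfolding window_sum_def sum_distrib_right mult.assoc trunc ..
      show ?thesis unfolding W D_def by (simp add: sum_subtractf right_diff_distrib algebra_simps)
    qed
    then have "energy (\<lambda>x. window_sum \<phi> F M a x - window_sum \<phi> F M a (x - s)) = energy (\<lambda>x. \<Sum>k\<in>F. D k x)"
      by presburger
    also have "\<dots> \<le> (2 * real p + 2) * (\<Sum>k\<in>F. energy (D k))"
    proof (rule energy_locally_finite_sum[OF F D])
      fix k x assume "x - real_of_int k \<notin> {- real p..real p + 1}"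
      then have "x - real_of_int k \<notin> {- real p + 1..real p}" "x - real_of_int k - s \<notin> {- real p + 1..real p}"
        using s d(2) by auto
      then show "D k x = 0" using supp by (simp add: D_def \<psi>_def)
    qed
    also have "\<dots> \<le> (2 * real p + 2) * (\<Sum>k\<in>F. (cmod (a k))\<^sup>2 * e')"
      by (intro mult_left_mono sum_mono eD) simp
    also have "\<dots> = e * (\<Sum>k\<in>F. (cmod (a k))\<^sup>2)"
      unfolding e'(2)[symmetric] by (simp add: sum_distrib_left sum_distrib_right mult_ac)
    finally show ?thesis .
  qed
  then show thesis using that d(1) by blast
qed

lemma periodic_shift:
  fixes a :: "int \<Rightarrow> 'a"
  assumes "\<And>k. a (k + int M) = a k"
  shows "a (k + int l * int M) = a k"
proof (induction l)
  case (Suc l)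
  have "a (k + int (Suc l) * int M) = a ((k + int l * int M) + int M)" by (simp add: algebra_simps)
  then show ?case using assms Suc by simp
qed simp

lemma periodic_mod:
  fixes a :: "int \<Rightarrow> 'a"
  assumes per: "\<And>k. a (k + int M) = a k"
  shows "a k = a (k mod int M)"
proof (cases "k div int M \<ge> 0")
  case True
  then obtain l where "k div int M = int l" using nonneg_int_cases by blast
  then have "k = k mod int M + int l * int M" by (metis mod_div_mult_eq)
  then show ?thesis using periodic_shift[of a, OF per] by metis
next
  case False
  define l where "l = nat (- (k div int M))"
  have "k div int M = - int l" using False by (simp add: l_def)
  then have "k mod int M = k + int l * int M" using mod_div_mult_eq[of k "int M"] by simp
  then show ?thesis using periodic_shift[of a, OF per] by metis
qed

lemma sum_periodic:
  fixes b :: "int \<Rightarrow> real"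
  assumes per: "\<And>k. b (k + int M) = b k"
  shows "(\<Sum>k\<in>{0..<int L * int M}. b k) = real L * (\<Sum>k\<in>{0..<int M}. b k)"
proof (induction L)
  case (Suc L)
  have "{0..<int (Suc L) * int M} = {0..<int L * int M} \<union> {int L * int M..<int L * int M + int M}"
    by (auto simp: algebra_simps) (smt (verit) mult_nonneg_nonneg of_nat_0_le_iff)+
  then have "(\<Sum>k\<in>{0..<int (Suc L) * int M}. b k)
      = (\<Sum>k\<in>{0..<int L * int M}. b k) + (\<Sum>k\<in>{int L * int M..<int L * int M + int M}. b k)"
    by (simp add: sum.union_disjoint ivl_disj_int)
  also have "(\<Sum>k\<in>{int L * int M..<int L * int M + int M}. b k) = (\<Sum>k\<in>{0..<int M}. b (k + int L * int M))"
    by (rule sum.reindex_bij_witness[of _ "\<lambda>k. k + int L * int M" "\<lambda>k. k - int L * int M"]) auto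
  also have "\<dots> = (\<Sum>k\<in>{0..<int M}. b k)" by (simp add: periodic_shift[of b, OF per])
  finally show ?case using Suc by (simp add: algebra_simps)
qed simp

text \<open>
  Apply the Riesz bound to \<open>L\<close> consecutive periods of the coefficients: both sides grow linearly
  in \<open>L\<close> with the claimed slopes, up to a boundary term that does not depend on \<open>L\<close>.
\<close>

lemma periodic_riesz_lower:
  fixes p M :: nat
  assumes phi: "sq_int \<phi>" and supp: "\<And>x. x \<notin> {- real p + 1..real p} \<Longrightarrow> \<phi> x = 0"
    and riesz: "\<And>F (a :: int \<Rightarrow> complex). finite F \<Longrightarrow>
       d1 * (\<Sum>k\<in>F. (cmod (a k))\<^sup>2) \<le> energy (\<lambda>x. \<Sum>k\<in>F. a k * \<phi> (x - real_of_int k))"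
    and d1: "d1 \<ge> 0" and M: "M > 0" and per: "\<And>k. a (k + int M) = a k"
    and F: "finite F" "{- int p..int M + int p} \<subseteq> F"
  shows "d1 * (\<Sum>k\<in>{0..<int M}. (cmod (a k))\<^sup>2) \<le> energy (window_sum \<phi> F M a)" (is "d1 * ?S \<le> energy ?h")
proof -
  define A where "A = (\<Sum>k\<in>{0..<int M}. cmod (a k))"
  have A0: "A \<ge> 0" unfolding A_def by (rule sum_nonneg) simp
  have aA: "cmod (a k) \<le> A" for k
  proof -
    have "cmod (a k) = cmod (a (k mod int M))" using periodic_mod[of a, OF per] by metis
    also have "\<dots> \<le> A" unfolding A_def using M by (intro member_le_sum) auto
    finally show ?thesis .
  qed
  define P where "P x = complex_of_real A * (\<Sum>k\<in>{- int p..int p}. complex_of_real (cmod (\<phi> (x - real_of_int k))))" for x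
  have P: "sq_int P"
  proof -
    have "sq_int (\<lambda>x. complex_of_real (cmod (\<phi> x)))"
      by (rule sq_int_mono[OF phi, where C=1]) (use phi in \<open>auto simp: sq_int_def\<close>)
    then show ?thesis unfolding P_def[abs_def]
      by (intro sq_int_cmult sq_int_sum sq_int_shift[of "\<lambda>x. complex_of_real (cmod (\<phi> x))"])
  qed
  have cP: "cmod (P x) = A * (\<Sum>k\<in>{- int p..int p}. cmod (\<phi> (x - real_of_int k)))" for x
  proof -
    have "P x = complex_of_real (A * (\<Sum>k\<in>{- int p..int p}. cmod (\<phi> (x - real_of_int k))))" by (simp add: P_def)
    then show ?thesis using A0 by (simp only: norm_of_real) (simp add: abs_mult sum_nonneg abs_of_nonneg)
  qed
  have h: "sq_int ?h" by (rule sq_int_window_sum[OF phi])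
  have win: "x - real p \<le> real_of_int k" "real_of_int k \<le> x + real p - 1" if "\<phi> (x - real_of_int k) \<noteq> 0" for x k
    using supp[of "x - real_of_int k"] that by force+
  have main: "real L * (d1 * ?S) \<le> real L * energy ?h + 2 * energy P" for L :: nat
  proof (cases "L = 0")
    case False
    let ?G = "\<lambda>x. \<Sum>k\<in>{- int p..int L * int M + int p}. a k * \<phi> (x - real_of_int k)"
    have pt: "(cmod (?G x))\<^sup>2 \<le> (\<Sum>l<L. (cmod (?h (x - real l * real M)))\<^sup>2)
        + (cmod (P x))\<^sup>2 + (cmod (P (x - real L * real M)))\<^sup>2" for x
    proof -
      have nn: "(\<Sum>l<L. (cmod (?h (x - real l * real M)))\<^sup>2) \<ge> 0" by (intro sum_nonneg) simp
      consider "x < 0" | "x > real L * real M" | "0 \<le> x" "x \<le> real L * real M" by linarith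
      then show ?thesis
      proof cases
        case 1
        have "cmod (?G x) \<le> (\<Sum>k\<in>{- int p..int L * int M + int p}. A * cmod (\<phi> (x - real_of_int k)))"
          by (rule sum_norm_le) (auto simp: norm_mult intro!: mult_right_mono aA)
        also have "\<dots> = (\<Sum>k\<in>{- int p..int p}. A * cmod (\<phi> (x - real_of_int k)))"
        proof (rule sum.mono_neutral_right)
          show "{- int p..int p} \<subseteq> {- int p..int L * int M + int p}" by auto
          show "\<forall>k\<in>{- int p..int L * int M + int p} - {- int p..int p}. A * cmod (\<phi> (x - real_of_int k)) = 0"
          proof
            fix k assume "k \<in> {- int p..int L * int M + int p} - {- int p..int p}"
            then have "int p < k" by auto
            then have "real p < real_of_int k" by linarith
            then show "A * cmod (\<phi> (x - real_of_int k)) = 0" using win(2)[of x k] 1 by auto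
          qed
        qed simp
        also have "\<dots> = cmod (P x)" by (simp add: cP sum_distrib_left)
        finally have "(cmod (?G x))\<^sup>2 \<le> (cmod (P x))\<^sup>2" by (intro power_mono) auto
        then show ?thesis using nn by (simp add: add_increasing add_increasing2)
      next
        case 2
        have "cmod (?G x) \<le> (\<Sum>k\<in>{- int p..int L * int M + int p}. A * cmod (\<phi> (x - real_of_int k)))"
          by (rule sum_norm_le) (auto simp: norm_mult intro!: mult_right_mono aA)
        also have "\<dots> = (\<Sum>k\<in>{int L * int M - int p..int L * int M + int p}. A * cmod (\<phi> (x - real_of_int k)))"
        proof (rule sum.mono_neutral_right)
          show "{int L * int M - int p..int L * int M + int p} \<subseteq> {- int p..int L * int M + int p}" by auto
          show "\<forall>k\<in>{- int p..int L * int M + int p} - {int L * int M - int p..int L * int M + int p}. A * cmod (\<phi> (x - real_of_int k)) = 0"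
          proof
            fix k assume k: "k \<in> {- int p..int L * int M + int p} - {int L * int M - int p..int L * int M + int p}"
            then have "real_of_int k < real_of_int (int L * int M - int p)" by (subst of_int_less_iff) auto
            then have "real_of_int k < x - real p" using 2 by simp
            then show "A * cmod (\<phi> (x - real_of_int k)) = 0" using win(1)[of x k] by auto
          qed
        qed simp
        also have "\<dots> = (\<Sum>k\<in>{- int p..int p}. A * cmod (\<phi> (x - real L * real M - real_of_int k)))"
          by (rule sum.reindex_bij_witness[of _ "\<lambda>k. k + int L * int M" "\<lambda>k. k - int L * int M"]) (auto simp: algebra_simps)
        also have "\<dots> = cmod (P (x - real L * real M))" by (simp add: cP sum_distrib_left)
        finally have "(cmod (?G x))\<^sup>2 \<le> (cmod (P (x - real L * real M)))\<^sup>2" by (intro power_mono) auto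
        then show ?thesis using nn by (simp add: add_increasing add_increasing2)
      next
        case 3
        obtain l where l: "l < L" "real l * real M \<le> x" "x \<le> real l * real M + real M"
        proof (cases "x = real L * real M")
          case True
          have "real L * real M = real (L - 1) * real M + real M" using False by (simp add: of_nat_diff algebra_simps)
          then show thesis using that[of "L - 1"] True False by (simp add: algebra_simps)
        next
          case neq: False
          define q where "q = nat \<lfloor>x / real M\<rfloor>"
          have xM: "0 \<le> x / real M" using 3 by simp
          have q: "real q \<le> x / real M" "x / real M < real q + 1" unfolding q_def using xM by (simp_all add: of_nat_nat)
          have "x / real M < real L" using 3 neq M by (simp add: divide_less_eq)
          then have "q < L" using q(1) by linarith
          moreover have "real q * real M \<le> x" "x \<le> real q * real M + real M"
            using q M by (simp_all add: field_simps)
          ultimately show thesis using that by blast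
        qed
        define y where "y = x - real l * real M"
        have y: "0 \<le> y" "y \<le> real M" using l by (auto simp: y_def)
        have "?h y = (\<Sum>k\<in>F. a k * \<phi> (y - real_of_int k))" using y by (simp add: window_sum_def)
        also have "\<dots> = (\<Sum>k\<in>{- int p..int M + int p}. a k * \<phi> (y - real_of_int k))"
        proof (rule sum.mono_neutral_right[OF F])
          show "\<forall>k\<in>F - {- int p..int M + int p}. a k * \<phi> (y - real_of_int k) = 0"
          proof
            fix k assume "k \<in> F - {- int p..int M + int p}"
            then have "k < - int p \<or> int M + int p < k" by auto
            then have "real_of_int k < - real p \<or> real M + real p < real_of_int k" by linarith
            then show "a k * \<phi> (y - real_of_int k) = 0" using win[of y k] y by auto
          qed
        qed
        also have "\<dots> = (\<Sum>k\<in>{int l * int M - int p..int l * int M + int M + int p}. a (k - int l * int M) * \<phi> (x - real_of_int k))"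
          by (rule sum.reindex_bij_witness[of _ "\<lambda>k. k - int l * int M" "\<lambda>k. k + int l * int M"]) (auto simp: y_def algebra_simps)
        also have "\<dots> = (\<Sum>k\<in>{int l * int M - int p..int l * int M + int M + int p}. a k * \<phi> (x - real_of_int k))"
          using periodic_shift[of a, OF per, of "k - int l * int M" l for k] by simp
        also have "\<dots> = ?G x"
        proof (rule sum.mono_neutral_left)
          have "int l + 1 \<le> int L" using l(1) by simp
          then have "(int l + 1) * int M \<le> int L * int M" by (intro mult_right_mono) auto
          moreover have "0 \<le> int l * int M" by simp
          ultimately show "{int l * int M - int p..int l * int M + int M + int p} \<subseteq> {- int p..int L * int M + int p}"
            by (auto simp: algebra_simps)
          show "\<forall>k\<in>{- int p..int L * int M + int p} - {int l * int M - int p..int l * int M + int M + int p}. a k * \<phi> (x - real_of_int k) = 0"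
          proof
            fix k assume k: "k \<in> {- int p..int L * int M + int p} - {int l * int M - int p..int l * int M + int M + int p}"
            then have "k < int l * int M - int p \<or> int l * int M + int M + int p < k" by auto
            then have "real_of_int k < real_of_int (int l * int M - int p) \<or> real_of_int (int l * int M + int M + int p) < real_of_int k"
              by (simp only: of_int_less_iff)
            then have "real_of_int k < x - real p \<or> x + real p - 1 < real_of_int k" using l by auto
            then show "a k * \<phi> (x - real_of_int k) = 0" using win[of x k] by auto
          qed
        qed simp
        finally have "(cmod (?G x))\<^sup>2 = (cmod (?h (x - real l * real M)))\<^sup>2" by (simp add: y_def)
        also have "\<dots> \<le> (\<Sum>l<L. (cmod (?h (x - real l * real M)))\<^sup>2)"
          by (rule member_le_sum) (use l in auto)
        finally show ?thesis by (simp add: add_increasing2)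
      qed
    qed
    have ih: "integrable lebesgue (\<lambda>x. (cmod (?h (x - c)))\<^sup>2)" and iP: "integrable lebesgue (\<lambda>x. (cmod (P (x - c)))\<^sup>2)" for c
      using sq_int_shift[OF h] sq_int_shift[OF P] by (simp_all add: sq_int_def)
    have "real L * ?S = (\<Sum>k\<in>{0..<int L * int M}. (cmod (a k))\<^sup>2)"
      by (rule sum_periodic[symmetric]) (simp add: per)
    also have "\<dots> \<le> (\<Sum>k\<in>{- int p..int L * int M + int p}. (cmod (a k))\<^sup>2)"
      by (rule sum_mono2) auto
    finally have "d1 * (real L * ?S) \<le> d1 * (\<Sum>k\<in>{- int p..int L * int M + int p}. (cmod (a k))\<^sup>2)"
      using d1 by (rule mult_left_mono)
    also have "\<dots> \<le> energy ?G" by (rule riesz) simp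
    also have "\<dots> \<le> (LINT x|lebesgue. (\<Sum>l<L. (cmod (?h (x - real l * real M)))\<^sup>2)
        + (cmod (P x))\<^sup>2 + (cmod (P (x - real L * real M)))\<^sup>2)"
      using ih iP iP[of 0] pt
      by (intro integral_mono' Bochner_Integration.integrable_add Bochner_Integration.integrable_sum)
        (auto intro!: add_nonneg_nonneg sum_nonneg)
    also have "\<dots> = (\<Sum>l<L. energy (\<lambda>x. ?h (x - real l * real M))) + energy P + energy (\<lambda>x. P (x - real L * real M))"
      using ih iP iP[of 0] by (simp add: Bochner_Integration.integral_sum)
    also have "\<dots> = real L * energy ?h + 2 * energy P"
      by (simp add: energy_shift)
    finally show ?thesis by (simp add: mult_ac)
  qed simp
  show ?thesis
  proof (rule ccontr)
    assume "\<not> ?thesis"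
    then have "d1 * ?S - energy ?h > 0" by simp
    then obtain L :: nat where "real L * (d1 * ?S - energy ?h) > 2 * energy P"
      using reals_Archimedean3 by blast
    then show False using main[of L] by (simp add: algebra_simps)
  qed
qed

section \<open>Gaussian averages of the Fourier transform\<close>

lemma borel_measurable_cnj [measurable]: "cnj \<in> borel_measurable borel"
  by (intro borel_measurable_continuous_onI continuous_intros)

lemma borel_measurable_cexp [measurable]: "(exp :: complex \<Rightarrow> complex) \<in> borel_measurable borel"
  by (intro borel_measurable_continuous_onI continuous_intros)

lemma LINT_gauss_cexp:
  "(CLINT w|std_normal_distribution. exp (- (2 * pi * \<i> * complex_of_real (\<sigma> * w * s))))
     = complex_of_real (exp (- (2 * pi * \<sigma> * s)\<^sup>2 / 2))"
  using fun_cong[OF char_std_normal_distribution, of "- (2 * pi * \<sigma> * s)"]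
  by (simp add: char_def mult_ac)

lemma norm_FT_kernel [simp]: "cmod (exp (- (2 * pi * \<i> * complex_of_real t))) = 1"
  using norm_exp_i_times[of "- (2 * pi * t)"] by (simp add: mult_ac)

lemma FT_lborel:
  assumes [measurable]: "f \<in> borel_measurable borel"
  shows "FT f w = (CLINT x|lborel. f x * exp (- (2 * pi * \<i> * complex_of_real (w * x))))"
  unfolding FT_def by (subst integral_completion) simp_all

lemma integrable_pair_mult:
  fixes f :: "'a \<Rightarrow> complex" and g :: "'b \<Rightarrow> complex"
  assumes "pair_sigma_finite M1 M2" and f: "integrable M1 f" and g: "integrable M2 g"
  shows "integrable (M1 \<Otimes>\<^sub>M M2) (\<lambda>z. f (fst z) * g (snd z))"
proof -
  interpret pair_sigma_finite M1 M2 by fact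
  have [measurable]: "f \<in> borel_measurable M1" "g \<in> borel_measurable M2" using f g by auto
  show ?thesis
  proof (rule Fubini_integrable)
    show "integrable M1 (\<lambda>x. \<integral>y. norm (f (fst (x, y)) * g (snd (x, y))) \<partial>M2)"
      using f g by (simp add: norm_mult)
    show "AE x in M1. integrable M2 (\<lambda>y. f (fst (x, y)) * g (snd (x, y)))"
      using g by simp
  qed measurable
qed

lemma integral_pair_mult:
  fixes f :: "'a \<Rightarrow> complex" and g :: "'b \<Rightarrow> complex"
  assumes "pair_sigma_finite M1 M2" and f: "integrable M1 f" and g: "integrable M2 g"
  shows "(CLINT z|(M1 \<Otimes>\<^sub>M M2). f (fst z) * g (snd z)) = (CLINT x|M1. f x) * (CLINT y|M2. g y)"
proof -
  interpret pair_sigma_finite M1 M2 by fact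
  show ?thesis
    using integral_fst'[OF integrable_pair_mult[OF assms]] by simp
qed

text \<open>Integrating against a Gaussian makes Fubini applicable, so no Plancherel theorem is needed.\<close>

lemma gaussian_identity:
  assumes [measurable]: "f \<in> borel_measurable borel"
    and f: "integrable lborel f"
  shows "(LINT w|std_normal_distribution. (cmod (FT f (\<sigma> * w)))\<^sup>2)
       = (LINT z|(lborel \<Otimes>\<^sub>M lborel). Re (f (fst z) * cnj (f (snd z))) * exp (- (2 * pi * \<sigma> * (fst z - snd z))\<^sup>2 / 2))"
proof -
  interpret N: prob_space std_normal_distribution
    using prob_space_normal_density by simp
  let ?P = "lborel \<Otimes>\<^sub>M lborel :: (real \<times> real) measure"
  interpret P: sigma_finite_measure ?P using lborel_pair.sigma_finite_measure_axioms .
  interpret NP: pair_sigma_finite std_normal_distribution ?P ..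
  let ?e = "\<lambda>w x. exp (- (2 * pi * \<i> * complex_of_real (w * x)))"
  let ?F = "\<lambda>z. f (fst z) * cnj (f (snd z))"
  have intF: "integrable ?P ?F"
  proof -
    show ?thesis
      using f by (intro integrable_pair_mult lborel_pair.pair_sigma_finite_axioms) auto
  qed
  have FT2: "complex_of_real ((cmod (FT f w))\<^sup>2) = (CLINT z|?P. ?F z * ?e w (fst z - snd z))" for w
  proof -
    have i: "integrable lborel (\<lambda>x. f x * ?e w x)"
      by (rule Bochner_Integration.integrable_bound[OF f]) (auto simp: norm_mult)
    have "complex_of_real ((cmod (FT f w))\<^sup>2) = FT f w * cnj (FT f w)"
      by (simp add: complex_norm_square del: of_real_power)
    also have "\<dots> = (CLINT x|lborel. f x * ?e w x) * (CLINT y|lborel. cnj (f y * ?e w y))"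
      by (simp only: FT_lborel[OF assms(1)] Bochner_Integration.integral_cnj)
    also have "\<dots> = (CLINT z|?P. (f (fst z) * ?e w (fst z)) * cnj (f (snd z) * ?e w (snd z)))"
      by (rule integral_pair_mult[symmetric]) (use i in \<open>auto simp del: complex_cnj_mult intro: lborel_pair.pair_sigma_finite_axioms\<close>)
    also have "\<dots> = (CLINT z|?P. ?F z * ?e w (fst z - snd z))"
      by (intro Bochner_Integration.integral_cong) (auto simp: exp_cnj mult_ac exp_add[symmetric] algebra_simps)
    finally show ?thesis .
  qed
  have "complex_of_real (LINT w|std_normal_distribution. (cmod (FT f (\<sigma> * w)))\<^sup>2)
      = (CLINT w|std_normal_distribution. complex_of_real ((cmod (FT f (\<sigma> * w)))\<^sup>2))"
    by (rule integral_complex_of_real[symmetric])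
  also have "\<dots> = (CLINT w|std_normal_distribution. CLINT z|?P. ?F z * ?e (\<sigma> * w) (fst z - snd z))"
    unfolding FT2 ..
  also have "\<dots> = (CLINT z|?P. CLINT w|std_normal_distribution. ?F z * ?e (\<sigma> * w) (fst z - snd z))"
  proof (rule NP.Fubini_integral[symmetric])
    have "integrable (std_normal_distribution \<Otimes>\<^sub>M ?P) (\<lambda>wz. 1 * ?F (snd wz))"
      by (rule integrable_pair_mult[OF NP.pair_sigma_finite_axioms _ intF]) simp
    then show "integrable (std_normal_distribution \<Otimes>\<^sub>M ?P) (\<lambda>(w, z). ?F z * ?e (\<sigma> * w) (fst z - snd z))"
    proof (rule Bochner_Integration.integrable_bound)
      have "sets (std_normal_distribution \<Otimes>\<^sub>M ?P) = sets (borel \<Otimes>\<^sub>M (borel \<Otimes>\<^sub>M borel))"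
        by (intro sets_pair_measure_cong) simp_all
      then show "(\<lambda>(w, z). ?F z * ?e (\<sigma> * w) (fst z - snd z)) \<in> borel_measurable (std_normal_distribution \<Otimes>\<^sub>M ?P)"
        by (subst measurable_cong_sets[OF _ refl, where M'="borel \<Otimes>\<^sub>M (borel \<Otimes>\<^sub>M borel)"]) (assumption, measurable)
    qed (auto simp: norm_mult)
  qed
  also have "\<dots> = (CLINT z|?P. ?F z * complex_of_real (exp (- (2 * pi * \<sigma> * (fst z - snd z))\<^sup>2 / 2)))"
    by (simp only: integral_mult_right_zero LINT_gauss_cexp)
  finally have *: "complex_of_real (LINT w|std_normal_distribution. (cmod (FT f (\<sigma> * w)))\<^sup>2) =
     (CLINT z|?P. ?F z * complex_of_real (exp (- (2 * pi * \<sigma> * (fst z - snd z))\<^sup>2 / 2)))" .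
  have intG: "integrable ?P (\<lambda>z. ?F z * complex_of_real (exp (- (2 * pi * \<sigma> * (fst z - snd z))\<^sup>2 / 2)))"
    by (rule Bochner_Integration.integrable_bound[OF intF]) (auto simp: norm_mult intro!: mult_left_le mult_nonneg_nonneg)
  have "(LINT w|std_normal_distribution. (cmod (FT f (\<sigma> * w)))\<^sup>2) =
     Re (CLINT z|?P. ?F z * complex_of_real (exp (- (2 * pi * \<sigma> * (fst z - snd z))\<^sup>2 / 2)))"
    using arg_cong[OF *, of Re] by simp
  also have "\<dots> = (LINT z|?P. Re (?F z * complex_of_real (exp (- (2 * pi * \<sigma> * (fst z - snd z))\<^sup>2 / 2))))"
    by (rule integral_Re[OF intG, symmetric])
  finally show ?thesis by (simp add: Re_complex_of_real)
qed

lemma gauss_kernel_eq: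
  assumes "\<sigma> > 0"
  shows "exp (- (2 * pi * \<sigma> * s)\<^sup>2 / 2) = normal_density 0 (1 / (2 * pi * \<sigma>)) s / (\<sigma> * sqrt (2 * pi))"
proof -
  have "sqrt (2 * pi * (1 / (2 * pi * \<sigma>))\<^sup>2) = sqrt (2 * pi) / (2 * pi * \<sigma>)"
    using assms by (simp add: real_sqrt_mult real_sqrt_divide)
  moreover have "sqrt (2 * pi) * sqrt (2 * pi) = 2 * pi" by simp
  ultimately have "1 / sqrt (2 * pi * (1 / (2 * pi * \<sigma>))\<^sup>2) = \<sigma> * sqrt (2 * pi)"
    using assms by (simp only:) (simp add: divide_simps)
  moreover have "- (s - 0)\<^sup>2 / (2 * (1 / (2 * pi * \<sigma>))\<^sup>2) = - (2 * pi * \<sigma> * s)\<^sup>2 / 2"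
    using assms by (simp add: field_simps power2_eq_square)
  ultimately show ?thesis
    using assms unfolding normal_density_def by simp
qed

lemma gauss_kernel_integral:
  assumes "\<sigma> > 0"
  shows "integrable lborel (\<lambda>s. exp (- (2 * pi * \<sigma> * s)\<^sup>2 / 2))"
    "(LINT s|lborel. exp (- (2 * pi * \<sigma> * s)\<^sup>2 / 2)) = 1 / (\<sigma> * sqrt (2 * pi))"
    "integrable lborel (\<lambda>s. exp (- (2 * pi * \<sigma> * s)\<^sup>2 / 2) * s\<^sup>2)"
    "(LINT s|lborel. exp (- (2 * pi * \<sigma> * s)\<^sup>2 / 2) * s\<^sup>2) = 1 / (\<sigma> * sqrt (2 * pi)) / (2 * pi * \<sigma>)\<^sup>2"
proof -
  have t: "1 / (2 * pi * \<sigma>) > 0" using assms by simp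
  show "integrable lborel (\<lambda>s. exp (- (2 * pi * \<sigma> * s)\<^sup>2 / 2))"
    unfolding gauss_kernel_eq[OF assms] using integrable_normal_density[OF t] by simp
  show "(LINT s|lborel. exp (- (2 * pi * \<sigma> * s)\<^sup>2 / 2)) = 1 / (\<sigma> * sqrt (2 * pi))"
    unfolding gauss_kernel_eq[OF assms] using integral_normal_density[OF t] by simp
  show "integrable lborel (\<lambda>s. exp (- (2 * pi * \<sigma> * s)\<^sup>2 / 2) * s\<^sup>2)"
    unfolding gauss_kernel_eq[OF assms] using integrable_normal_moment[OF t, of 0 2] by simp
  show "(LINT s|lborel. exp (- (2 * pi * \<sigma> * s)\<^sup>2 / 2) * s\<^sup>2) = 1 / (\<sigma> * sqrt (2 * pi)) / (2 * pi * \<sigma>)\<^sup>2"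
    unfolding gauss_kernel_eq[OF assms] using integral_normal_moment_even[OF t, of 0 1]
    by (simp add: power_divide power_mult_distrib eval_nat_numeral)
qed

lemma Re_mult_cnj_polar:
  "Re (a * cnj b) = (cmod a)\<^sup>2 / 2 + (cmod b)\<^sup>2 / 2 - (cmod (a - b))\<^sup>2 / 2"
  by (simp add: cmod_power2) (simp add: power2_eq_square field_simps)

lemma LINT_FT_gauss_bounds_borel:
  assumes [measurable]: "f \<in> borel_measurable borel"
    and f1: "integrable lborel f" and f2: "integrable lborel (\<lambda>x. (cmod (f x))\<^sup>2)" and \<sigma>: "\<sigma> > 0"
  defines "n \<equiv> (LINT x|lborel. (cmod (f x))\<^sup>2)"
  shows "(LINT w|std_normal_distribution. (cmod (FT f (\<sigma> * w)))\<^sup>2) \<le> n / (\<sigma> * sqrt (2 * pi))"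
    and "\<lbrakk>\<And>s. (LINT x|lborel. (cmod (f x - f (x - s)))\<^sup>2) \<le> (\<eta> + C * s\<^sup>2) * n; 0 \<le> \<eta>; 0 \<le> C\<rbrakk> \<Longrightarrow>
      n / (\<sigma> * sqrt (2 * pi)) * (1 - \<eta> / 2 - C / (2 * (2 * pi * \<sigma>)\<^sup>2))
        \<le> (LINT w|std_normal_distribution. (cmod (FT f (\<sigma> * w)))\<^sup>2)"
proof -
  let ?P = "lborel \<Otimes>\<^sub>M lborel :: (real \<times> real) measure"
  define g where "g s = exp (- (2 * pi * \<sigma> * s)\<^sup>2 / 2)" for s
  have [measurable]: "g \<in> borel_measurable borel" unfolding g_def[abs_def] by measurable
  have g0: "g s \<ge> 0" for s by (simp add: g_def)
  have n0: "n \<ge> 0" unfolding n_def by simp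
  define G where "G = 1 / (\<sigma> * sqrt (2 * pi))"
  have g1: "integrable lborel g" and g2: "(LINT s|lborel. g s) = G"
    and g3: "integrable lborel (\<lambda>s. g s * s\<^sup>2)" and g4: "(LINT s|lborel. g s * s\<^sup>2) = G / (2 * pi * \<sigma>)\<^sup>2"
    unfolding g_def[abs_def] G_def using gauss_kernel_integral[OF \<sigma>] by simp_all
  have gs: "integrable lborel (\<lambda>y. g (x - y))" "(LINT y|lborel. g (x - y)) = G" for x
    using lborel_integrable_real_affine[OF g1, of "-1" x] lborel_integral_real_affine[of "-1" g x] g2
    by simp_all
  have gsym: "g (x - y) = g (y - x)" for x y
    unfolding g_def by (simp add: power2_eq_square algebra_simps)
  let ?a = "\<lambda>(x, y). (cmod (f x))\<^sup>2 * g (x - y)"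
  let ?b = "\<lambda>(x, y). (cmod (f y))\<^sup>2 * g (x - y)"
  let ?d = "\<lambda>(x, y). (cmod (f x - f y))\<^sup>2 * g (x - y)"
  have ia: "integrable ?P ?a"
  proof (rule lborel_pair.Fubini_integrable)
    show "AE x in lborel. integrable lborel (\<lambda>y. ?a (x, y))" using gs by simp
    have "(\<lambda>x. LINT y|lborel. norm (?a (x, y))) = (\<lambda>x. (cmod (f x))\<^sup>2 * G)"
      using gs(2) g0 by (simp add: abs_mult)
    then show "integrable lborel (\<lambda>x. LINT y|lborel. norm (?a (x, y)))" using f2 by simp
  qed measurable
  have ea: "integral\<^sup>L ?P ?a = n * G"
    using lborel_pair.integral_fst'[OF ia] gs(2) by (simp add: n_def)
  have ib: "integrable ?P ?b" 
    using lborel_pair.integrable_product_swap[OF ia] by (simp add: case_prod_beta gsym)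
  have eb: "integral\<^sup>L ?P ?b = n * G"
    using lborel_pair.integral_product_swap[of ?a] ea by (simp add: case_prod_beta gsym)
  have id: "integrable ?P ?d"
  proof (rule Bochner_Integration.integrable_bound)
    show "integrable ?P (\<lambda>z. 2 * ?a z + 2 * ?b z)" using ia ib by simp
    have "(cmod (f x - f y))\<^sup>2 * g (x - y) \<le> 2 * ((cmod (f x))\<^sup>2 * g (x - y)) + 2 * ((cmod (f y))\<^sup>2 * g (x - y))" for x y
      using mult_right_mono[OF cmod_diff_sq_le[of "f x" "f y"] g0[of "x - y"]] by (simp add: algebra_simps)
    then show "AE z in ?P. norm (?d z) \<le> norm (2 * ?a z + 2 * ?b z)"
      using g0 by (auto simp: abs_mult intro!: AE_I2)
  qed measurable
  have "(LINT w|std_normal_distribution. (cmod (FT f (\<sigma> * w)))\<^sup>2) = (LINT z|?P. ?a z / 2 + ?b z / 2 - ?d z / 2)"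
    unfolding gaussian_identity[OF assms(1) f1] Re_mult_cnj_polar g_def[symmetric]
    by (intro Bochner_Integration.integral_cong) (auto simp: field_simps)
  also have "\<dots> = n * G - integral\<^sup>L ?P ?d / 2"
    using ia ib id ea eb by simp
  finally have eq: "(LINT w|std_normal_distribution. (cmod (FT f (\<sigma> * w)))\<^sup>2) = n * G - integral\<^sup>L ?P ?d / 2" .
  have d0: "integral\<^sup>L ?P ?d \<ge> 0"
    using g0 by (intro integral_nonneg_AE) auto
  show "(LINT w|std_normal_distribution. (cmod (FT f (\<sigma> * w)))\<^sup>2) \<le> n / (\<sigma> * sqrt (2 * pi))"
    using eq d0 by (simp add: G_def)
  assume L: "\<And>s. (LINT x|lborel. (cmod (f x - f (x - s)))\<^sup>2) \<le> (\<eta> + C * s\<^sup>2) * n" and "0 \<le> \<eta>" "0 \<le> C"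
  have fs: "integrable lborel (\<lambda>x. (cmod (f x - f (x - s)))\<^sup>2)" for s
  proof (rule Bochner_Integration.integrable_bound)
    show "integrable lborel (\<lambda>x. 2 * (cmod (f x))\<^sup>2 + 2 * (cmod (f (x - s)))\<^sup>2)"
      using f2 lborel_integrable_real_affine[OF f2, of 1 "- s"] by simp
  qed (use cmod_diff_sq_le in auto)
  have "ennreal (integral\<^sup>L ?P ?d) = (\<integral>\<^sup>+z. ennreal (?d z) \<partial>?P)"
    using g0 by (intro nn_integral_eq_integral[symmetric] id) auto
  also have "\<dots> = (\<integral>\<^sup>+x. \<integral>\<^sup>+y. ennreal ((cmod (f x - f y))\<^sup>2 * g (x - y)) \<partial>lborel \<partial>lborel)"
    by (subst lborel.nn_integral_fst[symmetric]) simp_all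
  also have "\<dots> = (\<integral>\<^sup>+x. \<integral>\<^sup>+s. ennreal ((cmod (f x - f (x - s)))\<^sup>2 * g s) \<partial>lborel \<partial>lborel)"
  proof (rule nn_integral_cong)
    fix x
    show "(\<integral>\<^sup>+y. ennreal ((cmod (f x - f y))\<^sup>2 * g (x - y)) \<partial>lborel)
        = (\<integral>\<^sup>+s. ennreal ((cmod (f x - f (x - s)))\<^sup>2 * g s) \<partial>lborel)"
      by (subst nn_integral_real_affine[of _ "-1" x]) simp_all
  qed
  also have "\<dots> = (\<integral>\<^sup>+s. \<integral>\<^sup>+x. ennreal ((cmod (f x - f (x - s)))\<^sup>2 * g s) \<partial>lborel \<partial>lborel)"
    by (rule lborel_pair.Fubini'[symmetric]) measurable
  also have "\<dots> = (\<integral>\<^sup>+s. ennreal ((LINT x|lborel. (cmod (f x - f (x - s)))\<^sup>2) * g s) \<partial>lborel)"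
    using fs g0 by (intro nn_integral_cong) (subst nn_integral_eq_integral, auto)
  also have "\<dots> \<le> (\<integral>\<^sup>+s. ennreal (\<eta> * n * g s + C * n * (g s * s\<^sup>2)) \<partial>lborel)"
  proof (intro nn_integral_mono ennreal_leI)
    fix s show "(LINT x|lborel. (cmod (f x - f (x - s)))\<^sup>2) * g s \<le> \<eta> * n * g s + C * n * (g s * s\<^sup>2)"
      using mult_right_mono[OF L[of s] g0[of s]] by (simp add: algebra_simps)
  qed
  also have "\<dots> = ennreal (LINT s|lborel. \<eta> * n * g s + C * n * (g s * s\<^sup>2))"
    using g1 g3 g0 n0 \<open>0 \<le> \<eta>\<close> \<open>0 \<le> C\<close> by (intro nn_integral_eq_integral) auto
  also have "(LINT s|lborel. \<eta> * n * g s + C * n * (g s * s\<^sup>2)) = \<eta> * n * G + C * n * (G / (2 * pi * \<sigma>)\<^sup>2)"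
    using g1 g2 g3 g4 by simp
  finally have "integral\<^sup>L ?P ?d \<le> \<eta> * n * G + C * n * (G / (2 * pi * \<sigma>)\<^sup>2)"
    using n0 \<open>0 \<le> \<eta>\<close> \<open>0 \<le> C\<close> \<sigma> by (subst (asm) ennreal_le_iff) (auto simp: G_def)
  then have "n * G * (1 - \<eta> / 2 - C / (2 * (2 * pi * \<sigma>)\<^sup>2)) \<le> n * G - integral\<^sup>L ?P ?d / 2"
    by (simp add: algebra_simps)
  then show "n / (\<sigma> * sqrt (2 * pi)) * (1 - \<eta> / 2 - C / (2 * (2 * pi * \<sigma>)\<^sup>2))
        \<le> (LINT w|std_normal_distribution. (cmod (FT f (\<sigma> * w)))\<^sup>2)"
    using eq by (simp add: G_def)
qed

lemma LINT_gauss_weight_eq: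
  assumes "\<sigma> > 0" and [measurable]: "h \<in> borel_measurable borel"
  shows "(LINT w|lborel. exp (- w\<^sup>2 / (2 * \<sigma>\<^sup>2)) * (h w :: real))
       = \<sigma> * sqrt (2 * pi) * (LINT w|std_normal_distribution. h (\<sigma> * w))"
proof -
  have "(LINT w|std_normal_distribution. h (\<sigma> * w)) = (LINT w|lborel. std_normal_density w * h (\<sigma> * w))"
    by (subst integral_density) auto
  also have "\<dots> = (LINT w|lborel. exp (- (\<sigma> * w)\<^sup>2 / (2 * \<sigma>\<^sup>2)) * h (\<sigma> * w)) / sqrt (2 * pi)"
    using assms(1) by (simp add: std_normal_density_def power_mult_distrib flip: integral_divide_zero)
  finally have "sqrt (2 * pi) * (LINT w|std_normal_distribution. h (\<sigma> * w))
      = (LINT w|lborel. exp (- (\<sigma> * w)\<^sup>2 / (2 * \<sigma>\<^sup>2)) * h (\<sigma> * w))" by simp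
  then show ?thesis
    using lborel_integral_real_affine[of \<sigma> "\<lambda>w. exp (- w\<^sup>2 / (2 * \<sigma>\<^sup>2)) * h w" 0] assms(1)
    by simp
qed

lemma FT_kernel_measurable [measurable]:
  "(\<lambda>x. exp (- (2 * pi * \<i> * complex_of_real (w * x)))) \<in> borel_measurable lebesgue"
proof -
  have "(\<lambda>x. exp (- (2 * pi * \<i> * complex_of_real (w * x)))) \<in> borel_measurable borel"
    by (intro borel_measurable_continuous_onI continuous_intros)
  then show ?thesis by (intro measurable_completion) simp
qed

lemma FT_integrable:
  assumes f: "integrable lebesgue f"
  shows "integrable lebesgue (\<lambda>x. f x * exp (- (2 * pi * \<i> * complex_of_real (w * x))))"
proof (rule Bochner_Integration.integrable_bound[OF f])
  have [measurable]: "f \<in> borel_measurable lebesgue" using f by simp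
  show "(\<lambda>x. f x * exp (- (2 * pi * \<i> * complex_of_real (w * x)))) \<in> borel_measurable lebesgue"
    by measurable
qed (simp add: norm_mult)

lemma FT_bound:
  assumes f: "integrable lebesgue f"
  shows "cmod (FT f w) \<le> (LINT x|lebesgue. cmod (f x))"
proof -
  have "cmod (FT f w) \<le> (LINT x|lebesgue. cmod (f x * exp (- (2 * pi * \<i> * complex_of_real (w * x)))))"
    unfolding FT_def by (rule integral_norm_bound)
  then show ?thesis by (simp add: norm_mult)
qed

lemma FT_cong_AE:
  assumes "f \<in> borel_measurable lebesgue" "g \<in> borel_measurable lebesgue" "AE x in lborel. f x = g x"
  shows "FT f = FT g"
proof
  fix w
  have "AE x in lebesgue. f x = g x" using assms(3) by (simp add: AE_completion_iff)
  then have ae: "AE x in lebesgue. f x * exp (- (2 * pi * \<i> * complex_of_real (w * x))) = g x * exp (- (2 * pi * \<i> * complex_of_real (w * x)))"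
    by eventually_elim simp
  show "FT f w = FT g w" unfolding FT_def using assms(1,2)
    by (intro integral_cong_AE borel_measurable_times FT_kernel_measurable ae)
qed

lemma cexp_remainder:
  "cmod (exp (- (2 * pi * \<i> * complex_of_real t)) - 1 + 2 * pi * \<i> * complex_of_real t) \<le> 2 * pi\<^sup>2 * t\<^sup>2"
  using iexp_approx1[of "- (2 * pi * t)" 1]
  by (simp add: mult_ac power_mult_distrib algebra_simps power2_eq_square)

lemma has_vector_derivative_FT:
  assumes f: "integrable lebesgue f" and supp: "\<And>x. x \<notin> {A..B} \<Longrightarrow> f x = 0"
    and f1: "integrable lebesgue (\<lambda>x. complex_of_real x * f x)"
  shows "(FT f has_vector_derivative FT (\<lambda>x. - (2 * pi * \<i>) * (complex_of_real x * f x)) w) (at w within S)"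
  unfolding has_vector_derivative_def
proof (rule has_derivativeI_sandwich[of 1])
  define M where "M = max \<bar>A\<bar> \<bar>B\<bar>"
  define Q where "Q = 2 * pi\<^sup>2 * M\<^sup>2 * (LINT x|lebesgue. cmod (f x))"
  let ?e = "\<lambda>w x. exp (- (2 * pi * \<i> * complex_of_real (w * x)))"
  let ?f1 = "\<lambda>x. - (2 * pi * \<i>) * (complex_of_real x * f x)"
  have i1: "integrable lebesgue ?f1" using f1 by (intro integrable_mult_right)
  show "((\<lambda>y. Q * \<bar>y - w\<bar>) \<longlongrightarrow> 0) (at w within S)"
    by (auto intro!: tendsto_eq_intros)
  fix v assume "v \<noteq> w"
  have "cmod (FT f v - FT f w - (v - w) *\<^sub>R FT ?f1 w)
      = cmod (CLINT x|lebesgue. f x * ?e v x - f x * ?e w x - (v - w) *\<^sub>R (?f1 x * ?e w x))"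
    unfolding FT_def
    using FT_integrable[OF f, of v] FT_integrable[OF f, of w] FT_integrable[OF i1, of w]
    by (simp del: minus_mult_left minus_mult_commute)
  also have "\<dots> \<le> (LINT x|lebesgue. 2 * pi\<^sup>2 * M\<^sup>2 * (v - w)\<^sup>2 * cmod (f x))"
  proof (rule Bochner_Integration.integral_norm_bound_integral)
    show "integrable lebesgue (\<lambda>x. f x * ?e v x - f x * ?e w x - (v - w) *\<^sub>R (?f1 x * ?e w x))"
      using FT_integrable[OF f, of v] FT_integrable[OF f, of w] FT_integrable[OF i1, of w]
      by (intro Bochner_Integration.integrable_diff integrable_scaleR_right)
    show "integrable lebesgue (\<lambda>x. 2 * pi\<^sup>2 * M\<^sup>2 * (v - w)\<^sup>2 * cmod (f x))" using f by simp
    fix x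
    show "cmod (f x * ?e v x - f x * ?e w x - (v - w) *\<^sub>R (?f1 x * ?e w x)) \<le> 2 * pi\<^sup>2 * M\<^sup>2 * (v - w)\<^sup>2 * cmod (f x)"
    proof (cases "x \<in> {A..B}")
      case True
      have ev: "?e v x = ?e w x * ?e (v - w) x"
        by (simp add: exp_add[symmetric] algebra_simps)
      have "f x * ?e v x - f x * ?e w x - (v - w) *\<^sub>R (?f1 x * ?e w x)
          = f x * ?e w x * (?e (v - w) x - 1 + 2 * pi * \<i> * complex_of_real ((v - w) * x))"
        unfolding ev by (simp add: algebra_simps scaleR_conv_of_real)
      then have "cmod (f x * ?e v x - f x * ?e w x - (v - w) *\<^sub>R (?f1 x * ?e w x))
          = cmod (f x) * cmod (?e (v - w) x - 1 + 2 * pi * \<i> * complex_of_real ((v - w) * x))"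
        by (simp only: norm_mult norm_FT_kernel mult_1_right)
      also have "\<dots> \<le> cmod (f x) * (2 * pi\<^sup>2 * ((v - w) * x)\<^sup>2)"
        by (intro mult_left_mono cexp_remainder) simp
      also have "\<dots> \<le> cmod (f x) * (2 * pi\<^sup>2 * ((v - w)\<^sup>2 * M\<^sup>2))"
      proof -
        have "\<bar>x\<bar> \<le> M" using True unfolding M_def by auto
        then have "x\<^sup>2 \<le> M\<^sup>2" by (metis abs_ge_zero power2_abs power_mono)
        then have "((v - w) * x)\<^sup>2 \<le> (v - w)\<^sup>2 * M\<^sup>2"
          unfolding power_mult_distrib by (rule mult_left_mono) simp
        then show ?thesis by (intro mult_left_mono) simp_all
      qed
      finally show ?thesis by (simp add: mult_ac)
    qed (use supp in simp)
  qed
  also have "\<dots> = Q * (v - w)\<^sup>2" 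
    unfolding Q_def integral_mult_right_zero by (simp only: mult_ac)
  finally have "cmod (FT f v - FT f w - (v - w) *\<^sub>R FT ?f1 w) \<le> Q * (v - w)\<^sup>2" .
  moreover have "Q * (v - w)\<^sup>2 = Q * \<bar>v - w\<bar> * norm (v - w)"
    by (simp only: real_norm_def mult.assoc abs_mult_self_eq power2_eq_square)
  moreover have "norm (v - w) > 0" using \<open>v \<noteq> w\<close> by simp
  ultimately show "cmod (FT f v - FT f w - (v - w) *\<^sub>R FT ?f1 w) / norm (v - w) \<le> Q * \<bar>v - w\<bar>"
    by (simp only: pos_divide_le_eq)
qed (auto intro: bounded_linear_scaleR_left)

lemma sq_int_mult_ident:
  assumes f: "sq_int f" and supp: "\<And>x. x \<notin> {A..B} \<Longrightarrow> f x = 0"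
  shows "sq_int (\<lambda>x. complex_of_real x * f x)"
proof (rule sq_int_mono[OF f])
  show "(\<lambda>x. complex_of_real x * f x) \<in> borel_measurable lebesgue"
  proof (rule borel_measurable_times)
    show "complex_of_real \<in> borel_measurable lebesgue" by (intro measurable_completion) simp
    show "f \<in> borel_measurable lebesgue" using f by (simp add: sq_int_def)
  qed
  show "cmod (complex_of_real x * f x) \<le> max \<bar>A\<bar> \<bar>B\<bar> * cmod (f x)" for x
    using supp[of x] by (cases "x \<in> {A..B}") (auto simp: norm_mult intro!: mult_right_mono)
qed

lemma has_vector_derivative_FT_sq_int:
  assumes f: "sq_int f" and supp: "\<And>x. x \<notin> {A..B} \<Longrightarrow> f x = 0"
  shows "(FT f has_vector_derivative FT (\<lambda>x. - (2 * pi * \<i>) * (complex_of_real x * f x)) w) (at w within S)"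
  by (rule has_vector_derivative_FT[of f A B])
    (use supp in \<open>auto intro!: sq_int_integrable[of _ A B] f sq_int_mult_ident[of f A B]\<close>)

lemma continuous_on_FT:
  assumes f: "sq_int f" and supp: "\<And>x. x \<notin> {A..B} \<Longrightarrow> f x = 0"
  shows "continuous_on S (FT f)"
  unfolding continuous_on_eq_continuous_within
  using has_vector_derivative_continuous[OF has_vector_derivative_FT_sq_int[OF assms]] by blast

lemma gauss_FT_integrable:
  assumes f: "sq_int f" and supp: "\<And>x. x \<notin> {A..B} \<Longrightarrow> f x = 0" and \<sigma>: "\<sigma> > 0"
  shows "integrable lborel (\<lambda>w. exp (- w\<^sup>2 / (2 * \<sigma>\<^sup>2)) * (cmod (FT f w))\<^sup>2)"
proof (rule Bochner_Integration.integrable_bound)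
  have [measurable]: "FT f \<in> borel_measurable borel"
    by (intro borel_measurable_continuous_onI continuous_on_FT[OF f supp])
  show "(\<lambda>w. exp (- w\<^sup>2 / (2 * \<sigma>\<^sup>2)) * (cmod (FT f w))\<^sup>2) \<in> borel_measurable lborel" by measurable
  let ?M = "LINT x|lebesgue. cmod (f x)"
  show "integrable lborel (\<lambda>w. sqrt (2 * pi * \<sigma>\<^sup>2) * normal_density 0 \<sigma> w * ?M\<^sup>2)"
    using integrable_normal_density[OF \<sigma>] by simp
  have eq: "sqrt (2 * pi * \<sigma>\<^sup>2) * normal_density 0 \<sigma> w = exp (- w\<^sup>2 / (2 * \<sigma>\<^sup>2))" for w
    using \<sigma> by (simp add: normal_density_def)
  have "(cmod (FT f w))\<^sup>2 \<le> ?M\<^sup>2" for w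
    by (intro power_mono FT_bound sq_int_integrable[OF f supp]) auto
  then show "AE w in lborel. norm (exp (- w\<^sup>2 / (2 * \<sigma>\<^sup>2)) * (cmod (FT f w))\<^sup>2)
        \<le> norm (sqrt (2 * pi * \<sigma>\<^sup>2) * normal_density 0 \<sigma> w * ?M\<^sup>2)"
    unfolding eq by (simp add: abs_mult)
qed

lemma gauss_FT_bounds:
  assumes f: "sq_int f" and supp: "\<And>x. x \<notin> {A..B} \<Longrightarrow> f x = 0" and \<sigma>: "\<sigma> > 0"
  shows "(LINT w|lborel. exp (- w\<^sup>2 / (2 * \<sigma>\<^sup>2)) * (cmod (FT f w))\<^sup>2) \<le> energy f"
    and "\<lbrakk>\<And>s. energy (\<lambda>x. f x - f (x - s)) \<le> (\<eta> + C * s\<^sup>2) * energy f; 0 \<le> \<eta>; 0 \<le> C\<rbrakk> \<Longrightarrow>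
      energy f * (1 - \<eta> / 2 - C / (2 * (2 * pi * \<sigma>)\<^sup>2))
        \<le> (LINT w|lborel. exp (- w\<^sup>2 / (2 * \<sigma>\<^sup>2)) * (cmod (FT f w))\<^sup>2)"
proof -
  have fm: "f \<in> borel_measurable lebesgue" using f by (simp add: sq_int_def)
  obtain g where g[measurable]: "g \<in> borel_measurable borel" and ae: "AE x in lborel. f x = g x"
    using lebesgue_borel_representative[OF fm] .
  have gl: "g \<in> borel_measurable lebesgue" using g by (intro measurable_completion) simp
  have FTg: "FT f = FT g" by (rule FT_cong_AE[OF fm gl ae])
  have [measurable]: "FT f \<in> borel_measurable borel"
    by (intro borel_measurable_continuous_onI continuous_on_FT[OF f supp])
  have ael: "AE x in lebesgue. f x = g x" using ae by (simp add: AE_completion_iff)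
  have g1: "integrable lborel g"
  proof -
    have "integrable lebesgue g"
      using integrable_cong_AE[OF fm gl ael] sq_int_integrable[OF f supp] by simp
    then show ?thesis by (simp add: integrable_completion)
  qed
  have aeE: "AE x in lebesgue. (cmod (f x))\<^sup>2 = (cmod (g x))\<^sup>2" using ael by eventually_elim simp
  have mf: "(\<lambda>x. (cmod (f x))\<^sup>2) \<in> borel_measurable lebesgue" using fm by measurable
  have mg: "(\<lambda>x. (cmod (g x))\<^sup>2) \<in> borel_measurable lborel" by measurable
  have g2: "integrable lborel (\<lambda>x. (cmod (g x))\<^sup>2)"
    using integrable_cong_AE[OF mf measurable_completion[OF mg] aeE] f mg
    by (simp add: sq_int_def integrable_completion)
  have en: "energy f = (LINT x|lborel. (cmod (g x))\<^sup>2)"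
    using integral_cong_AE[OF mf measurable_completion[OF mg] aeE] by (simp add: integral_completion)
  have en2: "energy (\<lambda>x. f x - f (x - s)) = (LINT x|lborel. (cmod (g x - g (x - s)))\<^sup>2)" for s
  proof -
    have fs: "(\<lambda>x. f (x - s)) \<in> borel_measurable lebesgue"
      using sq_int_shift[OF f] by (simp add: sq_int_def)
    have a: "(\<lambda>x. (cmod (f x - f (x - s)))\<^sup>2) \<in> borel_measurable lebesgue" using fm fs by measurable
    have b: "(\<lambda>x. (cmod (g x - g (x - s)))\<^sup>2) \<in> borel_measurable lborel" by measurable
    have "AE x in lborel. (cmod (f x - f (x - s)))\<^sup>2 = (cmod (g x - g (x - s)))\<^sup>2"
      using ae AE_lborel_shift[OF ae, of s] by eventually_elim simp
    then have "AE x in lebesgue. (cmod (f x - f (x - s)))\<^sup>2 = (cmod (g x - g (x - s)))\<^sup>2"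
      by (rule AE_completion)
    from integral_cong_AE[OF a measurable_completion[OF b] this] b show ?thesis
      by (simp add: integral_completion)
  qed
  have W: "(LINT w|lborel. exp (- w\<^sup>2 / (2 * \<sigma>\<^sup>2)) * (cmod (FT f w))\<^sup>2)
      = \<sigma> * sqrt (2 * pi) * (LINT w|std_normal_distribution. (cmod (FT g (\<sigma> * w)))\<^sup>2)"
    unfolding FTg[symmetric] by (rule LINT_gauss_weight_eq[OF \<sigma>]) measurable
  have pos: "\<sigma> * sqrt (2 * pi) > 0" using \<sigma> by simp
  note B = LINT_FT_gauss_bounds_borel[OF g g1 g2 \<sigma>]
  show "(LINT w|lborel. exp (- w\<^sup>2 / (2 * \<sigma>\<^sup>2)) * (cmod (FT f w))\<^sup>2) \<le> energy f"
    using mult_left_mono[OF B(1) less_imp_le[OF pos]] \<sigma> unfolding W en by simp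
  assume "\<And>s. energy (\<lambda>x. f x - f (x - s)) \<le> (\<eta> + C * s\<^sup>2) * energy f" "0 \<le> \<eta>" "0 \<le> C"
  then have "(LINT x|lborel. (cmod (g x))\<^sup>2) / (\<sigma> * sqrt (2 * pi)) * (1 - \<eta> / 2 - C / (2 * (2 * pi * \<sigma>)\<^sup>2))
        \<le> (LINT w|std_normal_distribution. (cmod (FT g (\<sigma> * w)))\<^sup>2)"
    unfolding en en2 by (rule B(2))
  from mult_left_mono[OF this less_imp_le[OF pos]] \<sigma>
  show "energy f * (1 - \<eta> / 2 - C / (2 * (2 * pi * \<sigma>)\<^sup>2))
        \<le> (LINT w|lborel. exp (- w\<^sup>2 / (2 * \<sigma>\<^sup>2)) * (cmod (FT f w))\<^sup>2)"
    unfolding W en by simp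
qed

lemma integral_interval_lborel:
  fixes h :: "real \<Rightarrow> real"
  assumes "continuous_on {a..b} h"
  shows "integrable lborel (\<lambda>x. indicator {a..b} x * h x)"
    and "integral {a..b} h = (LINT x|lborel. indicator {a..b} x * h x)"
proof -
  have s: "set_integrable lborel {a..b} h" by (rule borel_integrable_atLeastAtMost'[OF assms])
  then show "integrable lborel (\<lambda>x. indicator {a..b} x * h x)" by (simp add: set_integrable_def)
  show "integral {a..b} h = (LINT x|lborel. indicator {a..b} x * h x)"
    using set_borel_integral_eq_integral(2)[OF s] by (simp add: set_lebesgue_integral_def)
qed

lemma FT_bessel:
  assumes f: "sq_int f" and supp: "\<And>x. x \<notin> {A..B} \<Longrightarrow> f x = 0"
  shows "integral {a..b} (\<lambda>w. (cmod (FT f w))\<^sup>2) \<le> energy f"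
proof -
  define Q where "Q = max \<bar>a\<bar> \<bar>b\<bar>"
  have c: "continuous_on {a..b} (\<lambda>w. (cmod (FT f w))\<^sup>2)"
    by (intro continuous_intros continuous_on_FT[OF f supp])
  have *: "integral {a..b} (\<lambda>w. (cmod (FT f w))\<^sup>2) \<le> exp (Q\<^sup>2 * t) * energy f" if "t > 0" for t
  proof -
    define \<sigma> where "\<sigma> = 1 / sqrt (2 * t)"
    have \<sigma>: "\<sigma> > 0" "2 * \<sigma>\<^sup>2 = 1 / t" using that by (simp_all add: \<sigma>_def power_divide)
    have "integral {a..b} (\<lambda>w. (cmod (FT f w))\<^sup>2) = (LINT w|lborel. indicator {a..b} w * (cmod (FT f w))\<^sup>2)"
      by (rule integral_interval_lborel(2)[OF c])
    also have "\<dots> \<le> (LINT w|lborel. exp (Q\<^sup>2 * t) * (exp (- w\<^sup>2 / (2 * \<sigma>\<^sup>2)) * (cmod (FT f w))\<^sup>2))"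
    proof (rule integral_mono[OF integral_interval_lborel(1)[OF c]])
      show "integrable lborel (\<lambda>w. exp (Q\<^sup>2 * t) * (exp (- w\<^sup>2 / (2 * \<sigma>\<^sup>2)) * (cmod (FT f w))\<^sup>2))"
        using gauss_FT_integrable[OF f supp \<sigma>(1)] by simp
      fix w
      show "indicator {a..b} w * (cmod (FT f w))\<^sup>2 \<le> exp (Q\<^sup>2 * t) * (exp (- w\<^sup>2 / (2 * \<sigma>\<^sup>2)) * (cmod (FT f w))\<^sup>2)"
      proof (cases "w \<in> {a..b}")
        case True
        then have "\<bar>w\<bar> \<le> Q" unfolding Q_def by auto
        then have "w\<^sup>2 \<le> Q\<^sup>2" by (metis abs_ge_zero power2_abs power_mono)
        then have "1 \<le> exp (Q\<^sup>2 * t) * exp (- w\<^sup>2 / (2 * \<sigma>\<^sup>2))"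
          using that unfolding \<sigma>(2) by (simp add: mult_right_mono exp_add[symmetric] del: exp_add_commuting)
        from mult_right_mono[OF this, of "(cmod (FT f w))\<^sup>2"] show ?thesis using True by (simp add: mult.assoc)
      qed simp
    qed
    also have "\<dots> \<le> exp (Q\<^sup>2 * t) * energy f"
      using gauss_FT_bounds(1)[OF f supp \<sigma>(1)] by simp
    finally show ?thesis .
  qed
  have "((\<lambda>t. exp (Q\<^sup>2 * t) * energy f) \<longlongrightarrow> energy f) (at_right 0)"
    by (auto intro!: tendsto_eq_intros)
  then show ?thesis
    by (rule tendsto_lowerbound) (use * in \<open>auto intro: eventually_mono[OF eventually_at_right_less]\<close>)
qed

lemma FT_concentration:
  assumes f: "sq_int f" and supp: "\<And>x. x \<notin> {A..B} \<Longrightarrow> f x = 0" and \<sigma>: "\<sigma> > 0"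
    and smooth: "\<And>s. energy (\<lambda>x. f x - f (x - s)) \<le> (\<eta> + C * s\<^sup>2) * energy f" "0 \<le> \<eta>" "0 \<le> C"
    and T: "0 \<le> T" "a \<le> - T" "T \<le> b"
  shows "energy f * (1 - \<eta> / 2 - C / (2 * (2 * pi * \<sigma>)\<^sup>2) - exp (- T\<^sup>2 / (4 * \<sigma>\<^sup>2)))
    \<le> integral {a..b} (\<lambda>w. (cmod (FT f w))\<^sup>2)"
proof -
  let ?h = "\<lambda>w. (cmod (FT f w))\<^sup>2"
  have c: "continuous_on {a..b} ?h"
    by (intro continuous_intros continuous_on_FT[OF f supp])
  define \<tau> where "\<tau> = sqrt 2 * \<sigma>"
  have \<tau>: "\<tau> > 0" "\<tau>\<^sup>2 = 2 * \<sigma>\<^sup>2" using \<sigma> by (simp_all add: \<tau>_def power_mult_distrib)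
  have "energy f * (1 - \<eta> / 2 - C / (2 * (2 * pi * \<sigma>)\<^sup>2)) \<le> (LINT w|lborel. exp (- w\<^sup>2 / (2 * \<sigma>\<^sup>2)) * ?h w)"
    by (rule gauss_FT_bounds(2)[OF f supp \<sigma> smooth])
  also have "\<dots> \<le> (LINT w|lborel. indicator {a..b} w * ?h w + exp (- T\<^sup>2 / (4 * \<sigma>\<^sup>2)) * (exp (- w\<^sup>2 / (2 * \<tau>\<^sup>2)) * ?h w))"
  proof (rule integral_mono[OF gauss_FT_integrable[OF f supp \<sigma>]])
    show "integrable lborel (\<lambda>w. indicator {a..b} w * ?h w + exp (- T\<^sup>2 / (4 * \<sigma>\<^sup>2)) * (exp (- w\<^sup>2 / (2 * \<tau>\<^sup>2)) * ?h w))"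
      by (intro Bochner_Integration.integrable_add integrable_mult_right integral_interval_lborel(1)[OF c] gauss_FT_integrable[OF f supp \<tau>(1)])
    fix w
    show "exp (- w\<^sup>2 / (2 * \<sigma>\<^sup>2)) * ?h w \<le> indicator {a..b} w * ?h w + exp (- T\<^sup>2 / (4 * \<sigma>\<^sup>2)) * (exp (- w\<^sup>2 / (2 * \<tau>\<^sup>2)) * ?h w)"
    proof (cases "w \<in> {a..b}")
      case True
      have "exp (- w\<^sup>2 / (2 * \<sigma>\<^sup>2)) * ?h w \<le> 1 * ?h w"
        by (intro mult_right_mono) (auto simp: divide_nonneg_nonneg)
      then show ?thesis using True by (simp add: add_increasing2)
    next
      case False
      then have "T \<le> \<bar>w\<bar>" using T by auto
      then have "T\<^sup>2 \<le> w\<^sup>2" using T(1) by (metis power2_abs power_mono)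
      then have "- w\<^sup>2 / (2 * \<sigma>\<^sup>2) \<le> - T\<^sup>2 / (4 * \<sigma>\<^sup>2) + - w\<^sup>2 / (2 * \<tau>\<^sup>2)"
        unfolding \<tau>(2) using \<sigma> by (simp add: field_simps)
      then have "exp (- w\<^sup>2 / (2 * \<sigma>\<^sup>2)) \<le> exp (- T\<^sup>2 / (4 * \<sigma>\<^sup>2)) * exp (- w\<^sup>2 / (2 * \<tau>\<^sup>2))"
        by (simp only: exp_add[symmetric] exp_le_cancel_iff)
      from mult_right_mono[OF this, of "?h w"] show ?thesis using False by (simp add: mult.assoc)
    qed
  qed
  also have "\<dots> = integral {a..b} ?h + exp (- T\<^sup>2 / (4 * \<sigma>\<^sup>2)) * (LINT w|lborel. exp (- w\<^sup>2 / (2 * \<tau>\<^sup>2)) * ?h w)"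
    using integral_interval_lborel[OF c] gauss_FT_integrable[OF f supp \<tau>(1)] by simp
  also have "\<dots> \<le> integral {a..b} ?h + exp (- T\<^sup>2 / (4 * \<sigma>\<^sup>2)) * energy f"
    using gauss_FT_bounds(1)[OF f supp \<tau>(1)] by simp
  finally show ?thesis by (simp add: algebra_simps)
qed

section \<open>Sampling and the Wirtinger inequality\<close>

text \<open>
  With \<open>t x = tan (a (e - x))\<close> one has \<open>t' = - a (1 + t\<^sup>2)\<close>, hence
  \<open>|u'|\<^sup>2 - a\<^sup>2 |u|\<^sup>2 = |u' - a t u|\<^sup>2 + (a t |u|\<^sup>2)'\<close>, and the boundary terms vanish because
  \<open>t\<close> is zero at \<open>e\<close> and \<open>u\<close> at the other endpoint.
\<close>

lemma wirtinger_one_sided: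
  fixes u u' :: "real \<Rightarrow> complex"
  assumes u: "\<And>x. x \<in> {\<alpha>..\<beta>} \<Longrightarrow> (u has_vector_derivative u' x) (at x within {\<alpha>..\<beta>})"
    and u': "continuous_on {\<alpha>..\<beta>} u'" and ab: "\<alpha> \<le> \<beta>"
    and e: "\<And>x. x \<in> {\<alpha>, \<beta>} \<Longrightarrow> x = e \<or> u x = 0"
    and small: "\<And>x. x \<in> {\<alpha>..\<beta>} \<Longrightarrow> \<bar>a * (e - x)\<bar> < pi / 2"
  shows "a\<^sup>2 * integral {\<alpha>..\<beta>} (\<lambda>x. (cmod (u x))\<^sup>2) \<le> integral {\<alpha>..\<beta>} (\<lambda>x. (cmod (u' x))\<^sup>2)"
proof -
  define t where "t x = tan (a * (e - x))" for x
  have cos0: "cos (a * (e - x)) \<noteq> 0" if "x \<in> {\<alpha>..\<beta>}" for x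
    using small[OF that] by (intro less_imp_neq[symmetric] cos_gt_zero_pi) linarith+
  have cu: "continuous_on {\<alpha>..\<beta>} u"
    unfolding continuous_on_eq_continuous_within using has_vector_derivative_continuous[OF u] by blast
  have ct: "continuous_on {\<alpha>..\<beta>} t"
    unfolding t_def using cos0 by (intro continuous_intros) auto
  define W where "W x = a * t x * (u x \<bullet> u x)" for x
  define W' where "W' x = - a\<^sup>2 * (1 + (t x)\<^sup>2) * (u x \<bullet> u x) + 2 * a * t x * (u x \<bullet> u' x)" for x
  have "(W has_vector_derivative W' x) (at x within {\<alpha>..\<beta>})" if x: "x \<in> {\<alpha>..\<beta>}" for x
  proof -
    have dt: "(t has_real_derivative - a * (1 + (t x)\<^sup>2)) (at x within {\<alpha>..\<beta>})"
      unfolding t_def tan_sec[OF cos0[OF x]]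
      by (rule derivative_eq_intros refl cos0[OF x])+ (simp add: power_inverse)
    have du: "((\<lambda>x. u x \<bullet> u x) has_real_derivative 2 * (u x \<bullet> u' x)) (at x within {\<alpha>..\<beta>})"
      using bounded_bilinear.has_vector_derivative[OF bounded_bilinear_inner u[OF x] u[OF x]]
      by (simp add: has_real_derivative_iff_has_vector_derivative inner_commute)
    have "(W has_real_derivative W' x) (at x within {\<alpha>..\<beta>})"
      unfolding W_def[abs_def] W'_def
      by (rule derivative_eq_intros dt du refl | simp add: algebra_simps power2_eq_square)+
    then show ?thesis by (simp add: has_real_derivative_iff_has_vector_derivative)
  qed
  then have "(W' has_integral W \<beta> - W \<alpha>) {\<alpha>..\<beta>}"
    by (rule fundamental_theorem_of_calculus[OF ab])
  moreover have "W \<beta> = 0" "W \<alpha> = 0" using e[of \<alpha>] e[of \<beta>] by (auto simp: W_def t_def)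
  ultimately have W0: "(W' has_integral 0) {\<alpha>..\<beta>}" by simp
  have i1: "(\<lambda>x. (cmod (u' x))\<^sup>2) integrable_on {\<alpha>..\<beta>}"
    by (intro integrable_continuous_real continuous_intros u')
  have i2: "(\<lambda>x. (cmod (u x))\<^sup>2) integrable_on {\<alpha>..\<beta>}"
    by (intro integrable_continuous_real continuous_intros cu)
  have "((\<lambda>x. (cmod (u' x))\<^sup>2 - a\<^sup>2 * (cmod (u x))\<^sup>2 - W' x) has_integral
      integral {\<alpha>..\<beta>} (\<lambda>x. (cmod (u' x))\<^sup>2) - a\<^sup>2 * integral {\<alpha>..\<beta>} (\<lambda>x. (cmod (u x))\<^sup>2) - 0) {\<alpha>..\<beta>}"
    by (intro has_integral_diff has_integral_mult_right integrable_integral i1 i2 W0)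
  moreover have "(cmod (u' x))\<^sup>2 - a\<^sup>2 * (cmod (u x))\<^sup>2 - W' x = (cmod (u' x - (a * t x) *\<^sub>R u x))\<^sup>2" for x
    unfolding W'_def power2_norm_eq_inner
    by (simp add: inner_diff_left inner_diff_right inner_commute power2_eq_square algebra_simps)
  ultimately have "((\<lambda>x. (cmod (u' x - (a * t x) *\<^sub>R u x))\<^sup>2) has_integral
      integral {\<alpha>..\<beta>} (\<lambda>x. (cmod (u' x))\<^sup>2) - a\<^sup>2 * integral {\<alpha>..\<beta>} (\<lambda>x. (cmod (u x))\<^sup>2) - 0) {\<alpha>..\<beta>}"
    by simp
  from has_integral_nonneg[OF this] show ?thesis by simp
qed

lemma wirtinger_sample:
  fixes u u' :: "real \<Rightarrow> complex"
  assumes u: "\<And>x. x \<in> {l..r} \<Longrightarrow> (u has_vector_derivative u' x) (at x within {l..r})"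
    and u': "continuous_on {l..r} u'" and c: "l \<le> c" "c \<le> r"
    and a: "0 \<le> a" "a * (r - c) < pi / 2" "a * (c - l) < pi / 2"
  shows "a\<^sup>2 * integral {l..r} (\<lambda>x. (cmod (u x - u c))\<^sup>2) \<le> integral {l..r} (\<lambda>x. (cmod (u' x))\<^sup>2)"
proof -
  have cu: "continuous_on {l..r} u"
    unfolding continuous_on_eq_continuous_within using has_vector_derivative_continuous[OF u] by blast
  have d: "((\<lambda>x. u x - u c) has_vector_derivative u' x) (at x within S)" if "x \<in> S" "S \<subseteq> {l..r}" for x S
    using has_vector_derivative_within_subset[OF u that(2)] that
    by (auto intro!: derivative_eq_intros)
  have R: "a\<^sup>2 * integral {c..r} (\<lambda>x. (cmod (u x - u c))\<^sup>2) \<le> integral {c..r} (\<lambda>x. (cmod (u' x))\<^sup>2)"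
  proof (rule wirtinger_one_sided[where e=r])
    fix x assume x: "x \<in> {c..r}"
    have "0 \<le> a * (r - x)" "a * (r - x) \<le> a * (r - c)"
      using x a(1) by (auto intro!: mult_left_mono)
    then show "\<bar>a * (r - x)\<bar> < pi / 2" using a by linarith
  qed (use c d in \<open>auto intro: continuous_on_subset[OF u']\<close>)
  have L: "a\<^sup>2 * integral {l..c} (\<lambda>x. (cmod (u x - u c))\<^sup>2) \<le> integral {l..c} (\<lambda>x. (cmod (u' x))\<^sup>2)"
  proof (rule wirtinger_one_sided[where e=l])
    fix x assume x: "x \<in> {l..c}"
    have "0 \<le> a * (x - l)" "a * (x - l) \<le> a * (c - l)"
      using x a(1) by (auto intro!: mult_left_mono)
    then show "\<bar>a * (l - x)\<bar> < pi / 2" using a by (simp add: abs_less_iff algebra_simps)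
  qed (use c d in \<open>auto intro: continuous_on_subset[OF u']\<close>)
  have i: "(\<lambda>x. (cmod (u' x))\<^sup>2) integrable_on {l..r}" "(\<lambda>x. (cmod (u x - u c))\<^sup>2) integrable_on {l..r}"
    by (intro integrable_continuous_real continuous_intros u' cu)+
  show ?thesis
    unfolding Henstock_Kurzweil_Integration.integral_combine[OF c i(1), symmetric]
      Henstock_Kurzweil_Integration.integral_combine[OF c i(2), symmetric]
    using R L by (simp add: distrib_left)
qed

lemma cmod_sq_le_weighted:
  assumes "t > 0"
  shows "(cmod a)\<^sup>2 \<le> (1 + t) * (cmod b)\<^sup>2 + (1 + 1 / t) * (cmod (a - b))\<^sup>2"
proof -
  have "2 * (sqrt t * cmod b) * (cmod (a - b) / sqrt t) \<le> (sqrt t * cmod b)\<^sup>2 + (cmod (a - b) / sqrt t)\<^sup>2"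
    by (rule sum_squares_bound)
  then have *: "2 * cmod b * cmod (a - b) \<le> t * (cmod b)\<^sup>2 + (cmod (a - b))\<^sup>2 / t"
    using assms by (simp add: power_mult_distrib power_divide)
  have "cmod a \<le> cmod b + cmod (a - b)" using norm_triangle_ineq[of b "a - b"] by simp
  then have "(cmod a)\<^sup>2 \<le> (cmod b + cmod (a - b))\<^sup>2" by (intro power_mono) auto
  then show ?thesis using * by (simp add: power2_sum algebra_simps)
qed

lemma sum_integral_adjacent:
  fixes h :: "real \<Rightarrow> real"
  assumes h: "\<And>S. continuous_on S h" and z: "\<And>n. n < N \<Longrightarrow> z n \<le> z (Suc n)"
  shows "z 0 \<le> z N \<and> (\<Sum>n<N. integral {z n..z (Suc n)} h) = integral {z 0..z N} h"
  using z
proof (induction N)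
  case (Suc N)
  then have IH: "z 0 \<le> z N" "(\<Sum>n<N. integral {z n..z (Suc n)} h) = integral {z 0..z N} h" "z N \<le> z (Suc N)"
    by auto
  have "integral {z 0..z N} h + integral {z N..z (Suc N)} h = integral {z 0..z (Suc N)} h"
    using IH by (intro Henstock_Kurzweil_Integration.integral_combine integrable_continuous_real h)
  then show ?case using IH by simp
qed simp

text \<open>The \<open>n\<close>-th node, for \<open>1 \<le> n \<le> N\<close>, lies between \<open>cell (n - 1)\<close> and \<open>cell n\<close>.\<close>

definition cell :: "real \<Rightarrow> nat \<Rightarrow> (nat \<Rightarrow> real) \<Rightarrow> nat \<Rightarrow> real" where
  "cell K N w n = (wext K N w n + wext K N w (Suc n)) / 2"

lemma mu_cell: "mu K N w (Suc n) = cell K N w (Suc n) - cell K N w n"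
  by (simp add: mu_def cell_def field_simps)

lemma dense_scheme_cells:
  assumes D: "dense_scheme K \<delta> N w"
  shows "\<And>n. n < N \<Longrightarrow> cell K N w n \<le> w (Suc n)"
    and "\<And>n. n < N \<Longrightarrow> w (Suc n) \<le> cell K N w (Suc n)"
    and "\<And>n. n < N \<Longrightarrow> w (Suc n) - cell K N w n \<le> \<delta> / 2"
    and "\<And>n. n < N \<Longrightarrow> cell K N w (Suc n) - w (Suc n) \<le> \<delta> / 2"
    and "cell K N w 0 \<le> - (K - 1 / 2)" and "K - 1 / 2 \<le> cell K N w N"
proof -
  have N: "1 \<le> N" and K: "0 < K" and \<delta>: "0 < \<delta>" "\<delta> < 1" using D by (auto simp: dense_scheme_def)
  have rng: "- K \<le> w n" "w n \<le> K" if "1 \<le> n" "n \<le> N" for n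
    using D that by (auto simp: dense_scheme_def)
  have gap: "wext K N w (Suc n) - wext K N w n \<le> \<delta>" if "n \<le> N" for n
    using D that by (auto simp: dense_scheme_def)
  have ext: "wext K N w (Suc n) = w (Suc n)" if "n < N" for n using that by (simp add: wext_def)
  have mono: "wext K N w n \<le> wext K N w (Suc n)" if "n \<le> N" for n
  proof -
    consider "n = 0" | "n = N" "n \<noteq> 0" | "n \<noteq> 0" "n \<noteq> N" by blast
    then show ?thesis
    proof cases
      case 1
      then show ?thesis using rng[of 1] rng[of N] N K by (auto simp: wext_def)
    next
      case 2
      then show ?thesis using rng[of 1] rng[of N] N K by (auto simp: wext_def)
    next
      case 3
      with that have "1 \<le> n" "n < N" by auto
      moreover from this have "w n < w (n + 1)" using D unfolding dense_scheme_def by auto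
      ultimately show ?thesis by (simp add: wext_def)
    qed
  qed
  fix n assume n: "n < N"
  note * = mono[of n] mono[of "Suc n"] gap[of n] gap[of "Suc n"] ext[OF n]
  show "cell K N w n \<le> w (Suc n)" "w (Suc n) \<le> cell K N w (Suc n)"
    "w (Suc n) - cell K N w n \<le> \<delta> / 2" "cell K N w (Suc n) - w (Suc n) \<le> \<delta> / 2"
    using * n unfolding cell_def by (auto simp: field_simps)
next
  have N: "1 \<le> N" and K: "0 < K" and \<delta>: "0 < \<delta>" "\<delta> < 1" using D by (auto simp: dense_scheme_def)
  have rng: "- K \<le> w 1" "w 1 \<le> K" "- K \<le> w N" "w N \<le> K"
    using D N by (auto simp: dense_scheme_def)
  have "wext K N w (0 + 1) - wext K N w 0 \<le> \<delta>" using D by (auto simp: dense_scheme_def)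
  then have g: "w 1 - w N + 2 * K \<le> \<delta>" using N by (simp add: wext_def)
  show "cell K N w 0 \<le> - (K - 1 / 2)" "K - 1 / 2 \<le> cell K N w N"
    using rng g \<delta> N by (simp_all add: cell_def wext_def)
qed

text \<open>The centred support halves the bound on the derivative; this makes the constant \<open>\<delta>\<close> exact.\<close>

lemma sampling_error:
  assumes D: "dense_scheme K \<delta> N w" and f: "sq_int f" and supp: "\<And>x. x \<notin> {-1/2..1/2} \<Longrightarrow> f x = 0"
  shows "(\<Sum>n<N. integral {cell K N w n..cell K N w (Suc n)} (\<lambda>x. (cmod (FT f x - FT f (w (Suc n))))\<^sup>2))
     \<le> \<delta>\<^sup>2 * energy f" (is "?E \<le> _")
proof -
  have \<delta>: "0 < \<delta>" using D by (auto simp: dense_scheme_def)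
  define g where "g x = - (2 * pi * \<i>) * (complex_of_real x * f x)" for x
  have g: "sq_int g" unfolding g_def[abs_def] by (intro sq_int_cmult sq_int_mult_ident[OF f supp])
  have gs: "g x = 0" if "x \<notin> {-1/2..1/2}" for x using supp[OF that] by (simp add: g_def)
  have deriv: "(FT f has_vector_derivative FT g x) (at x within S)" for x S
    unfolding g_def[abs_def] by (rule has_vector_derivative_FT_sq_int[OF f supp])
  have cg: "continuous_on S (FT g)" for S by (rule continuous_on_FT[OF g gs])
  note dc = dense_scheme_cells[OF D]
  have *: "a\<^sup>2 * ?E \<le> pi\<^sup>2 * energy f" if a: "0 < a" "a * \<delta> < pi" for a
  proof -
    have "a\<^sup>2 * ?E = (\<Sum>n<N. a\<^sup>2 * integral {cell K N w n..cell K N w (Suc n)} (\<lambda>x. (cmod (FT f x - FT f (w (Suc n))))\<^sup>2))"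
      by (rule sum_distrib_left)
    also have "\<dots> \<le> (\<Sum>n<N. integral {cell K N w n..cell K N w (Suc n)} (\<lambda>x. (cmod (FT g x))\<^sup>2))"
    proof (rule sum_mono)
      fix n assume "n \<in> {..<N}"
      then have n: "n < N" by simp
      have "a * (cell K N w (Suc n) - w (Suc n)) \<le> a * (\<delta> / 2)" "a * (w (Suc n) - cell K N w n) \<le> a * (\<delta> / 2)"
        using a dc(3,4)[OF n] by (auto intro!: mult_left_mono)
      then have "a * (cell K N w (Suc n) - w (Suc n)) < pi / 2" "a * (w (Suc n) - cell K N w n) < pi / 2"
        using a by linarith+
      then show "a\<^sup>2 * integral {cell K N w n..cell K N w (Suc n)} (\<lambda>x. (cmod (FT f x - FT f (w (Suc n))))\<^sup>2)
         \<le> integral {cell K N w n..cell K N w (Suc n)} (\<lambda>x. (cmod (FT g x))\<^sup>2)"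
        using a by (intro wirtinger_sample deriv cg dc(1,2)[OF n]) simp_all
    qed
    also have "\<dots> = integral {cell K N w 0..cell K N w N} (\<lambda>x. (cmod (FT g x))\<^sup>2)"
      by (rule sum_integral_adjacent[THEN conjunct2])
        (intro continuous_intros cg, rule order_trans[OF dc(1,2)])
    also have "\<dots> \<le> energy g" by (rule FT_bessel[OF g gs])
    also have "\<dots> \<le> (LINT x|lebesgue. pi\<^sup>2 * (cmod (f x))\<^sup>2)"
    proof (rule integral_mono)
      fix x
      show "(cmod (g x))\<^sup>2 \<le> pi\<^sup>2 * (cmod (f x))\<^sup>2"
      proof (cases "x \<in> {-1/2..1/2}")
        case True
        then have "2 * \<bar>x\<bar> \<le> 1" by auto
        then have "pi * cmod (f x) * (2 * \<bar>x\<bar>) \<le> pi * cmod (f x) * 1" by (intro mult_left_mono) auto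
        moreover have "cmod (g x) = pi * cmod (f x) * (2 * \<bar>x\<bar>)" by (simp add: g_def norm_mult)
        ultimately have "cmod (g x) \<le> pi * cmod (f x)" by simp
        from power_mono[OF this, of 2] show ?thesis by (simp add: power_mult_distrib)
      qed (use gs in simp)
    qed (use f g in \<open>auto simp: sq_int_def\<close>)
    finally show ?thesis by simp
  qed
  have ev: "\<forall>\<^sub>F a in at_left (pi / \<delta>). a\<^sup>2 * ?E \<le> pi\<^sup>2 * energy f"
  proof -
    have "\<forall>\<^sub>F a in at_left (pi / \<delta>). a \<in> {0<..<pi / \<delta>}" using \<delta> by (intro eventually_at_left_real) simp
    then show ?thesis by eventually_elim (use * \<delta> in \<open>auto simp: field_simps\<close>)
  qed
  have "((\<lambda>a. a\<^sup>2 * ?E) \<longlongrightarrow> (pi / \<delta>)\<^sup>2 * ?E) (at_left (pi / \<delta>))" by (intro tendsto_intros)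
  from tendsto_upperbound[OF this ev] have "(pi / \<delta>)\<^sup>2 * ?E \<le> pi\<^sup>2 * energy f" by simp
  then show ?thesis using \<delta> by (simp add: power_divide field_simps)
qed

lemma FT_half_shift: "FT (\<lambda>x. f (x + 1 / 2)) w = exp (pi * \<i> * complex_of_real w) * FT f w"
proof -
  have "FT f w = (CLINT x|lebesgue. f (x + 1 / 2) * exp (- (2 * pi * \<i> * complex_of_real (w * (x + 1 / 2)))))"
    unfolding FT_def
    using lebesgue_integral_real_affine[of 1 "\<lambda>x. f x * exp (- (2 * pi * \<i> * complex_of_real (w * x)))" "1 / 2"]
    by (simp add: add.commute)
  also have "\<dots> = (CLINT x|lebesgue. exp (- (pi * \<i> * complex_of_real w)) * (f (x + 1 / 2) * exp (- (2 * pi * \<i> * complex_of_real (w * x)))))"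
    by (intro Bochner_Integration.integral_cong) (auto simp: exp_add[symmetric] algebra_simps)
  also have "\<dots> = exp (- (pi * \<i> * complex_of_real w)) * FT (\<lambda>x. f (x + 1 / 2)) w"
    by (simp only: FT_def integral_mult_right_zero)
  finally show ?thesis by (simp add: exp_minus)
qed

lemma sampling_bounds:
  assumes D: "dense_scheme K \<delta> N w" and f: "f \<in> Hspace" and t: "t > 0"
  defines "X \<equiv> (\<Sum>n=1..N. mu K N w n * (cmod (FT f (w n)))\<^sup>2)"
  defines "Y \<equiv> integral {cell K N w 0..cell K N w N} (\<lambda>x. (cmod (FT f x))\<^sup>2)"
  shows "X \<le> (1 + t) * Y + (1 + 1 / t) * (\<delta>\<^sup>2 * energy f)"
    and "Y \<le> (1 + t) * X + (1 + 1 / t) * (\<delta>\<^sup>2 * energy f)"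
proof -
  define h where "h x = f (x + 1 / 2)" for x
  have h: "sq_int h" unfolding h_def[abs_def]
    using sq_int_shift[of f "- (1 / 2)"] f by (simp add: Hspace_def)
  have hs: "h x = 0" if "x \<notin> {-1/2..1/2}" for x
    using f that by (auto simp: Hspace_def h_def)
  have eh: "energy h = energy f" unfolding h_def[abs_def] using energy_shift[of f "- (1 / 2)"] by simp
  have Fh: "cmod (FT f x) = cmod (FT h x)" for x
  proof -
    have "cmod (exp (pi * \<i> * complex_of_real x)) = 1" using norm_exp_i_times[of "pi * x"] by (simp add: mult_ac)
    then show ?thesis unfolding h_def[abs_def] FT_half_shift by (simp add: norm_mult)
  qed
  have ch: "continuous_on S (FT h)" for S by (rule continuous_on_FT[OF h hs])
  note dc = dense_scheme_cells[OF D]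
  let ?I = "\<lambda>n. {cell K N w n..cell K N w (Suc n)}"
  let ?c = "\<lambda>n. FT h (w (Suc n))"
  define E where "E = (\<Sum>n<N. integral (?I n) (\<lambda>x. (cmod (FT h x - ?c n))\<^sup>2))"
  have E: "E \<le> \<delta>\<^sup>2 * energy f" unfolding E_def eh[symmetric] by (rule sampling_error[OF D h hs])
  have mono: "cell K N w n \<le> cell K N w (Suc n)" if "n < N" for n
    using dc(1,2)[OF that] by simp
  have X: "X = (\<Sum>n<N. integral (?I n) (\<lambda>x. (cmod (?c n))\<^sup>2))"
  proof -
    have "X = (\<Sum>n<N. mu K N w (Suc n) * (cmod (?c n))\<^sup>2)"
      unfolding X_def Fh by (simp add: sum.atLeast1_atMost_eq)
    also have "\<dots> = (\<Sum>n<N. integral (?I n) (\<lambda>x. (cmod (?c n))\<^sup>2))"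
      using mono by (intro sum.cong refl) (simp add: mu_cell)
    finally show ?thesis .
  qed
  have Y: "Y = (\<Sum>n<N. integral (?I n) (\<lambda>x. (cmod (FT h x))\<^sup>2))"
    unfolding Y_def Fh
    by (rule sum_integral_adjacent[THEN conjunct2, symmetric]) (intro continuous_intros ch, rule mono)
  have ic: "(\<lambda>x. (cmod (?c n))\<^sup>2) integrable_on ?I n" "(\<lambda>x. (cmod (FT h x))\<^sup>2) integrable_on ?I n"
     "(\<lambda>x. (cmod (FT h x - ?c n))\<^sup>2) integrable_on ?I n" for n
    by (intro integrable_continuous_real continuous_intros ch)+
  have 1: "1 + 1 / t \<ge> 0" using t by simp
  have comb: "integral (?I n) (\<lambda>x. p * P x + q * Q x) = p * integral (?I n) P + q * integral (?I n) Q"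
    "(\<lambda>x. p * P x + q * Q x) integrable_on ?I n"
    if "P integrable_on ?I n" "Q integrable_on ?I n" for p q :: real and P Q n
  proof -
    have "((\<lambda>x. p * P x + q * Q x) has_integral p * integral (?I n) P + q * integral (?I n) Q) (?I n)"
      by (intro has_integral_add has_integral_mult_right integrable_integral that)
    then show "integral (?I n) (\<lambda>x. p * P x + q * Q x) = p * integral (?I n) P + q * integral (?I n) Q"
      "(\<lambda>x. p * P x + q * Q x) integrable_on ?I n"
      by (auto simp: integral_unique has_integral_integrable)
  qed
  have "X \<le> (\<Sum>n<N. integral (?I n) (\<lambda>x. (1 + t) * (cmod (FT h x))\<^sup>2 + (1 + 1 / t) * (cmod (FT h x - ?c n))\<^sup>2))"
    unfolding X using cmod_sq_le_weighted[OF t]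
    by (intro sum_mono integral_le comb ic) (metis norm_minus_commute)
  also have "\<dots> = (1 + t) * Y + (1 + 1 / t) * E"
    unfolding Y E_def by (simp add: comb(1)[OF ic(2,3)] sum.distrib sum_distrib_left)
  also have "\<dots> \<le> (1 + t) * Y + (1 + 1 / t) * (\<delta>\<^sup>2 * energy f)"
    using E 1 by (intro add_left_mono mult_left_mono)
  finally show "X \<le> (1 + t) * Y + (1 + 1 / t) * (\<delta>\<^sup>2 * energy f)" .
  have "Y \<le> (\<Sum>n<N. integral (?I n) (\<lambda>x. (1 + t) * (cmod (?c n))\<^sup>2 + (1 + 1 / t) * (cmod (FT h x - ?c n))\<^sup>2))"
    unfolding Y using cmod_sq_le_weighted[OF t]
    by (intro sum_mono integral_le comb ic)
  also have "\<dots> = (1 + t) * X + (1 + 1 / t) * E"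
    unfolding X E_def by (simp add: comb(1)[OF ic(1,3)] sum.distrib sum_distrib_left)
  also have "\<dots> \<le> (1 + t) * X + (1 + 1 / t) * (\<delta>\<^sup>2 * energy f)"
    using E 1 by (intro add_left_mono mult_left_mono)
  finally show "Y \<le> (1 + t) * X + (1 + 1 / t) * (\<delta>\<^sup>2 * energy f)" .
qed

lemma qform_eq:
  assumes f: "f \<in> Hspace"
  shows "qform K N w f = (\<Sum>n=1..N. mu K N w n * (cmod (FT f (w n)))\<^sup>2)"
proof -
  let ?e = "\<lambda>v x. exp (- (2 * pi * \<i> * complex_of_real (v * x)))"
  have supp: "f x = 0" if "x \<notin> {0..1}" for x using f that by (simp add: Hspace_def)
  have i: "integrable lebesgue (\<lambda>x. f x * ?e v x)" for v
    using f supp by (intro FT_integrable sq_int_integrable[of f 0 1]) (auto simp: Hspace_def)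
  have ic: "integrable lebesgue (\<lambda>x. cnj (f x * ?e v x))" for v
    using i[of v] by (rule integrable_cnj)
  have "Sop K N w f x * cnj (f x) = (\<Sum>n=1..N. complex_of_real (mu K N w n) * FT f (w n) * cnj (f x * ?e (w n) x))" for x
  proof (cases "x \<in> {0..1}")
    case True
    then show ?thesis
      by (simp add: Sop_def exp_cnj sum_distrib_left sum_distrib_right mult_ac)
  qed (simp add: supp)
  then have "L2inner (Sop K N w f) f = (CLINT x|lebesgue. \<Sum>n=1..N. complex_of_real (mu K N w n) * FT f (w n) * cnj (f x * ?e (w n) x))"
    unfolding L2inner_def by presburger
  also have "\<dots> = (\<Sum>n=1..N. complex_of_real (mu K N w n) * FT f (w n) * cnj (FT f (w n)))"
    unfolding FT_def using ic
    by (subst Bochner_Integration.integral_sum)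
      (auto simp del: complex_cnj_mult simp: Bochner_Integration.integral_cnj)
  also have "\<dots> = complex_of_real (\<Sum>n=1..N. mu K N w n * (cmod (FT f (w n)))\<^sup>2)"
    by (simp add: complex_norm_square mult.assoc del: of_real_power)
  finally show ?thesis unfolding qform_def by simp
qed

section \<open>The reconstruction space\<close>

lemma per_dil_eq:
  assumes supp: "\<And>x. x \<notin> {- real p + 1..real p} \<Longrightarrow> \<phi> x = 0"
    and x: "x \<in> {0..1}" and k: "k < 2 ^ R"
  shows "per (dil \<phi> (int R) (int k)) x
    = (\<Sum>l\<in>{- int p - 1..int p + 1}. complex_of_real (2 powr (real R / 2)) * \<phi> (2 ^ R * x - real_of_int (int k - l * 2 ^ R)))"
proof -
  let ?g = "\<lambda>l :: int. complex_of_real (2 powr (real R / 2)) * \<phi> (2 ^ R * x - real_of_int (int k - l * 2 ^ R))"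
  have d: "dil \<phi> (int R) (int k) (x + real_of_int l) = ?g l" for l
    by (simp add: dil_def powr_realpow algebra_simps)
  have z: "?g l = 0" if "l \<notin> {- int p - 1..int p + 1}" for l
  proof -
    have M: "(1 :: real) \<le> 2 ^ R" by simp
    have kM: "real k + 1 \<le> 2 ^ R" using k by (metis Suc_eq_plus1 Suc_leI of_nat_Suc of_nat_le_iff of_nat_numeral of_nat_power add.commute)
    have eq: "2 ^ R * x - real_of_int (int k - l * 2 ^ R) = 2 ^ R * (x + real_of_int l) - real k"
      by (simp add: algebra_simps)
    have "2 ^ R * x - real_of_int (int k - l * 2 ^ R) \<notin> {- real p + 1..real p}"
    proof (cases "l > 0")
      case True
      then have "real p + 2 \<le> real_of_int l" using that by auto
      then have "real p + 2 \<le> x + real_of_int l" using x by auto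
      then have "2 ^ R * (real p + 2) \<le> 2 ^ R * (x + real_of_int l)" by (intro mult_left_mono) auto
      moreover have "1 * (real p + 1) \<le> 2 ^ R * (real p + 1)" using M by (intro mult_right_mono) auto
      ultimately have "2 ^ R * (x + real_of_int l) - real k > real p" using kM by (simp add: algebra_simps)
      then show ?thesis unfolding eq by simp
    next
      case False
      then have "real_of_int l \<le> - (real p + 2)" using that by auto
      then have "x + real_of_int l \<le> - (real p + 1)" using x by auto
      then have "2 ^ R * (x + real_of_int l) \<le> 2 ^ R * (- (real p + 1))" by (intro mult_left_mono) auto
      moreover have "1 * (real p + 1) \<le> 2 ^ R * (real p + 1)" using M by (intro mult_right_mono) auto
      ultimately have "2 ^ R * (x + real_of_int l) - real k < - real p + 1" by (simp add: algebra_simps)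
      then show ?thesis unfolding eq by simp
    qed
    then show ?thesis using supp by simp
  qed
  have "per (dil \<phi> (int R) (int k)) x = (\<Sum>\<^sub>\<infinity> l :: int. ?g l)"
    unfolding per_def d ..
  also have "\<dots> = (\<Sum>\<^sub>\<infinity> l\<in>{- int p - 1..int p + 1}. ?g l)"
    by (rule infsum_cong_neutral) (use z in auto)
  finally show ?thesis by simp
qed

lemma Tspace_window_sum:
  assumes supp: "\<And>x. x \<notin> {- real p + 1..real p} \<Longrightarrow> \<phi> x = 0" and f: "f \<in> Tspace \<phi> R"
  obtains a :: "int \<Rightarrow> complex" where "\<And>k. a (k + int (2 ^ R)) = a k"
    "\<And>x. f x = complex_of_real (2 powr (real R / 2)) *
       window_sum \<phi> {- (int p + 1) * 2 ^ R..<(int p + 2) * 2 ^ R} (2 ^ R) a (2 ^ R * x)"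
proof -
  let ?s = "complex_of_real (2 powr (real R / 2))" and ?M = "2 ^ R :: int"
  let ?F = "{- (int p + 1) * ?M..<(int p + 2) * ?M}"
  obtain c :: "nat \<Rightarrow> complex" where c: "f = (\<lambda>x. (\<Sum>k<2^R. c k * per (dil \<phi> (int R) (int k)) x) * indicator {0..1} x)"
    using f by (auto simp: Tspace_def)
  define a where "a k = c (nat (k mod ?M))" for k
  have M: "?M > 0" by simp
  have "f x = ?s * window_sum \<phi> ?F (2 ^ R) a (2 ^ R * x)" for x
  proof (cases "x \<in> {0..1}")
    case True
    have div: "- (k div ?M) \<in> {- int p - 1..int p + 1}" if "k \<in> ?F" for k
    proof -
      have "k = k div ?M * ?M + k mod ?M" by (rule div_mult_mod_eq[symmetric])
      moreover have "0 \<le> k mod ?M" "k mod ?M < ?M" using M by auto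
      ultimately have "k div ?M * ?M \<le> k" "k < (k div ?M + 1) * ?M" by (simp_all only: distrib_right)
      then have "k div ?M * ?M < (int p + 2) * ?M" "- (int p + 1) * ?M < (k div ?M + 1) * ?M"
        using that unfolding atLeastLessThan_iff by (blast intro: le_less_trans)+
      then have "k div ?M < int p + 2" "- (int p + 1) < k div ?M + 1"
        using M by (simp_all only: mult_less_cancel_right_pos)
      then show ?thesis by auto
    qed
    have pd: "per (dil \<phi> (int R) (int k)) x
      = (\<Sum>l\<in>{- int p - 1..int p + 1}. ?s * \<phi> (2 ^ R * x - real_of_int (int k - l * ?M)))" if "k < 2 ^ R" for k
      by (rule per_dil_eq[OF supp True that])
    have "f x = (\<Sum>k<2^R. c k * per (dil \<phi> (int R) (int k)) x)" using True by (simp add: c)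
    also have "\<dots> = (\<Sum>k<2^R. \<Sum>l\<in>{- int p - 1..int p + 1}. c k * (?s * \<phi> (2 ^ R * x - real_of_int (int k - l * ?M))))"
      by (intro sum.cong refl) (simp only: pd sum_distrib_left lessThan_iff)
    also have "\<dots> = (\<Sum>(k, l)\<in>{..<2^R} \<times> {- int p - 1..int p + 1}. c k * (?s * \<phi> (2 ^ R * x - real_of_int (int k - l * ?M))))"
      by (rule sum.cartesian_product)
    also have "\<dots> = (\<Sum>k\<in>?F. a k * (?s * \<phi> (2 ^ R * x - real_of_int k)))"
    proof (rule sum.reindex_bij_witness[of _ "\<lambda>k. (nat (k mod ?M), - (k div ?M))" "\<lambda>(k, l). int k - l * ?M"])
      fix kl :: "nat \<times> int" assume kl: "kl \<in> {..<2^R} \<times> {- int p - 1..int p + 1}"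
      obtain k l where kl': "kl = (k, l)" by (cases kl)
      have "int k < int (2 ^ R)" using kl kl' by (simp only: of_nat_less_iff) auto
      then have k: "int k < ?M" by simp
      have l: "- int p - 1 \<le> l" "l \<le> int p + 1" using kl kl' by auto
      have eq: "int k - l * ?M = int k + (- l) * ?M" by simp
      have mod: "(int k - l * ?M) mod ?M = int k"
        unfolding eq mod_mult_self1 using k by (intro mod_pos_pos_trivial) auto
      have "int k div ?M = 0" using k by (intro div_pos_pos_trivial) auto
      then have dv: "(int k - l * ?M) div ?M = - l"
        unfolding eq using M div_mult_self1[of ?M "int k" "- l"] by simp
      show "(\<lambda>k. (nat (k mod ?M), - (k div ?M))) ((\<lambda>(k, l). int k - l * ?M) kl) = kl"
        using mod dv by (simp add: kl')
      have "- (int p + 1) * N \<le> int k - l * N \<and> int k - l * N < (int p + 2) * N"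
        if N: "int k < N" for N :: int
      proof -
        have "(- int p - 1) * N \<le> l * N" "l * N \<le> (int p + 1) * N" using l N by (auto intro!: mult_right_mono)
        then show ?thesis using N by (simp add: algebra_simps)
      qed
      from this[OF k] show "(\<lambda>(k, l). int k - l * ?M) kl \<in> ?F" by (simp only: kl' prod.case atLeastLessThan_iff)
      show "a ((\<lambda>(k, l). int k - l * ?M) kl) * (?s * \<phi> (2 ^ R * x - real_of_int ((\<lambda>(k, l). int k - l * ?M) kl)))
        = (case kl of (k, l) \<Rightarrow> c k * (?s * \<phi> (2 ^ R * x - real_of_int (int k - l * ?M))))"
        using mod by (simp add: kl' a_def)
    next
      fix k assume k: "k \<in> ?F"
      show "(\<lambda>(k, l). int k - l * ?M) ((\<lambda>k. (nat (k mod ?M), - (k div ?M))) k) = k"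
        using M mod_div_mult_eq[of k ?M] by simp
      have "nat (k mod ?M) < 2 ^ R" using M by (simp add: nat_less_iff)
      then show "(\<lambda>k. (nat (k mod ?M), - (k div ?M))) k \<in> {..<2^R} \<times> {- int p - 1..int p + 1}"
        using div[OF k] by simp
    qed
    also have "\<dots> = ?s * window_sum \<phi> ?F (2 ^ R) a (2 ^ R * x)"
      using True by (simp add: window_sum_def sum_distrib_left mult_ac indicator_def)
    finally show ?thesis .
  next
    case False
    moreover have pos: "(2 :: real) ^ R > 0" by simp
    ultimately have "2 ^ R * x \<notin> {0..real (2 ^ R)}"
      using mult_le_cancel_left_pos[OF pos, of 0 x] mult_le_cancel_left_pos[OF pos, of x 1] by simp
    then show ?thesis using False by (simp add: c window_sum_def)
  qed
  moreover have "a (k + int (2 ^ R)) = a k" for k by (simp add: a_def)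
  ultimately show thesis using that by blast
qed

lemma energy_scale:
  fixes R :: nat
  shows "energy (\<lambda>x. complex_of_real (2 powr (real R / 2)) * h (2 ^ R * x)) = energy h"
proof -
  have "(2 powr (real R / 2))\<^sup>2 = (2::real) ^ R"
    by (simp add: powr_realpow[symmetric] powr_powr[symmetric] flip: powr_numeral)
      (simp add: powr_powr)
  then show ?thesis
    using lebesgue_integral_real_affine[of "2 ^ R" "\<lambda>x. (cmod (h x))\<^sup>2" 0]
    by (simp add: norm_mult power_mult_distrib)
qed

lemma energy_translate_le:
  assumes "sq_int f" shows "energy (\<lambda>x. f x - f (x - s)) \<le> 4 * energy f"
proof -
  have i: "integrable lebesgue (\<lambda>x. (cmod (f x))\<^sup>2)" "integrable lebesgue (\<lambda>x. (cmod (f (x - s)))\<^sup>2)"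
    using assms sq_int_shift[OF assms] by (simp_all add: sq_int_def)
  have "energy (\<lambda>x. f x - f (x - s)) \<le> (LINT x|lebesgue. 2 * (cmod (f x))\<^sup>2 + 2 * (cmod (f (x - s)))\<^sup>2)"
    using i cmod_diff_sq_le by (intro integral_mono') auto
  also have "\<dots> = 4 * energy f" using i by (simp add: energy_shift)
  finally show ?thesis .
qed

lemma Tspace_smooth:
  assumes phi: "sq_int \<phi>" and supp: "\<And>x. x \<notin> {- real p + 1..real p} \<Longrightarrow> \<phi> x = 0"
    and riesz: "riesz_translates \<phi>" and \<eta>: "\<eta> > 0"
  obtains C where "C \<ge> 0"
    "\<And>R f s. f \<in> Tspace \<phi> R \<Longrightarrow> energy (\<lambda>x. f x - f (x - s)) \<le> (\<eta> + C * (2 ^ R * s)\<^sup>2) * energy f"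
proof -
  obtain d1 where d1: "d1 > 0" "\<And>F (a :: int \<Rightarrow> complex). finite F \<Longrightarrow>
       d1 * (\<Sum>k\<in>F. (cmod (a k))\<^sup>2) \<le> energy (\<lambda>x. \<Sum>k\<in>F. a k * \<phi> (x - real_of_int k))"
    using riesz unfolding riesz_translates_def L2norm_sq by blast
  define q where "q = 2 * int p + 3"
  have q: "q > 0" by (simp add: q_def)
  define e where "e = \<eta> * d1 / real_of_int q"
  have e: "e > 0" using \<eta> d1 q by (simp add: e_def)
  obtain d where d: "0 < d"
    "\<And>M F a s. \<lbrakk>finite F; \<bar>s\<bar> < d\<rbrakk> \<Longrightarrow>
       energy (\<lambda>x. window_sum \<phi> F M a x - window_sum \<phi> F M a (x - s)) \<le> e * (\<Sum>k\<in>F. (cmod (a k))\<^sup>2)"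
    using window_sum_translation[OF phi supp e] by blast
  have "energy (\<lambda>x. f x - f (x - s)) \<le> (\<eta> + 4 / d\<^sup>2 * (2 ^ R * s)\<^sup>2) * energy f"
    if f: "f \<in> Tspace \<phi> R" for R f s
  proof -
    let ?s = "complex_of_real (2 powr (real R / 2))"
    let ?F = "{- (int p + 1) * 2 ^ R..<(int p + 2) * 2 ^ R} :: int set"
    obtain a :: "int \<Rightarrow> complex" where per: "\<And>k. a (k + int (2 ^ R)) = a k"
      and fa: "\<And>x. f x = ?s * window_sum \<phi> ?F (2 ^ R) a (2 ^ R * x)"
      using Tspace_window_sum[OF supp f] by blast
    let ?h = "window_sum \<phi> ?F (2 ^ R) a"
    let ?t = "2 ^ R * s"
    have h: "sq_int ?h" by (rule sq_int_window_sum[OF phi])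
    have "f = (\<lambda>x. ?s * ?h (2 ^ R * x))" using fa by blast
    then have ef: "energy f = energy ?h" using energy_scale[of R ?h] by simp
    have "f x - f (x - s) = ?s * (?h (2 ^ R * x) - ?h (2 ^ R * x - ?t))" for x
      unfolding fa by (simp add: right_diff_distrib)
    then have es: "energy (\<lambda>x. f x - f (x - s)) = energy (\<lambda>y. ?h y - ?h (y - ?t))"
      using energy_scale[of R "\<lambda>y. ?h y - ?h (y - ?t)"] by presburger
    have eh: "energy ?h \<ge> 0" by simp
    show ?thesis
    proof (cases "\<bar>?t\<bar> < d")
      case True
      let ?S = "\<Sum>k\<in>{0..<int (2 ^ R)}. (cmod (a k))\<^sup>2"
      have "(\<Sum>k\<in>?F. (cmod (a k))\<^sup>2) = (\<Sum>k\<in>{0..<int (2 * p + 3) * int (2 ^ R)}. (cmod (a (k - (int p + 1) * 2 ^ R)))\<^sup>2)"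
        by (rule sum.reindex_bij_witness[of _ "\<lambda>k. k - (int p + 1) * 2 ^ R" "\<lambda>k. k + (int p + 1) * 2 ^ R"])
          (auto simp: algebra_simps)
      also have "\<dots> = (\<Sum>k\<in>{0..<int (2 * p + 3) * int (2 ^ R)}. (cmod (a k))\<^sup>2)"
      proof (rule sum.cong)
        fix k
        show "(cmod (a (k - (int p + 1) * 2 ^ R)))\<^sup>2 = (cmod (a k))\<^sup>2"
          using periodic_shift[of a "2 ^ R" "k - (int p + 1) * 2 ^ R" "Suc p", OF per] by (simp add: algebra_simps)
      qed simp
      also have "\<dots> = real (2 * p + 3) * ?S"
        by (rule sum_periodic) (use per in simp)
      finally have sF: "(\<Sum>k\<in>?F. (cmod (a k))\<^sup>2) = real_of_int q * ?S" by (simp add: q_def)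
      have S: "d1 * ?S \<le> energy ?h"
      proof (rule periodic_riesz_lower[OF phi supp d1(2)])
        have "(1 :: int) \<le> 2 ^ R" by simp
        then have "(int p + 1) * 1 \<le> (int p + 1) * 2 ^ R" by (intro mult_left_mono) auto
        then show "{- int p..int (2 ^ R) + int p} \<subseteq> ?F" by (auto simp: algebra_simps)
      qed (use d1 per in auto)
      have "energy (\<lambda>y. ?h y - ?h (y - ?t)) \<le> e * (\<Sum>k\<in>?F. (cmod (a k))\<^sup>2)"
        by (rule d(2)) (use True in auto)
      also have "\<dots> = \<eta> * (d1 * ?S)" unfolding sF e_def using q by simp
      also have "\<dots> \<le> \<eta> * energy ?h" using S \<eta> by (intro mult_left_mono) auto
      also have "\<dots> \<le> (\<eta> + 4 / d\<^sup>2 * ?t\<^sup>2) * energy ?h" using eh by (intro mult_right_mono) auto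
      finally show ?thesis unfolding es ef .
    next
      case False
      then have "d\<^sup>2 \<le> \<bar>?t\<bar>\<^sup>2" using d(1) by (intro power_mono) auto
      then have "4 \<le> 4 / d\<^sup>2 * ?t\<^sup>2" using d(1) by (simp add: field_simps)
      then have "4 * energy ?h \<le> (\<eta> + 4 / d\<^sup>2 * ?t\<^sup>2) * energy ?h" using \<eta> eh by (intro mult_right_mono) linarith+
      then show ?thesis unfolding es ef using energy_translate_le[OF h, of ?t] by linarith
    qed
  qed
  then show thesis using that[of "4 / d\<^sup>2"] by simp
qed

lemma Tspace_Hspace:
  assumes phi: "sq_int \<phi>" and supp: "\<And>x. x \<notin> {- real p + 1..real p} \<Longrightarrow> \<phi> x = 0" and f: "f \<in> Tspace \<phi> R"
  shows "f \<in> Hspace"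
proof -
  obtain a where fa: "\<And>x. f x = complex_of_real (2 powr (real R / 2)) *
       window_sum \<phi> {- (int p + 1) * 2 ^ R..<(int p + 2) * 2 ^ R} (2 ^ R) a (2 ^ R * x)"
    using Tspace_window_sum[OF supp f] by blast
  have "sq_int f" unfolding fa[abs_def]
    using sq_int_affine[OF sq_int_window_sum[OF phi], of "2 ^ R" _ _ _ 0] by (intro sq_int_cmult) simp
  moreover have "f x = 0" if "x \<notin> {0..1}" for x using f that by (auto simp: Tspace_def)
  ultimately show ?thesis by (simp add: Hspace_def)
qed

lemma Tspace_concentration:
  assumes phi: "sq_int \<phi>" and supp: "\<And>x. x \<notin> {- real p + 1..real p} \<Longrightarrow> \<phi> x = 0"
    and riesz: "riesz_translates \<phi>" and \<epsilon>: "\<epsilon> > 0"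
  obtains c0 where "\<And>R f K a b. \<lbrakk>f \<in> Tspace \<phi> R; c0 * 2 ^ R \<le> K; a \<le> - (K - 1 / 2); K - 1 / 2 \<le> b\<rbrakk> \<Longrightarrow>
     (1 - \<epsilon>) * energy f \<le> integral {a..b} (\<lambda>w. (cmod (FT f w))\<^sup>2)"
proof -
  obtain C where C: "C \<ge> 0"
    "\<And>R f s. f \<in> Tspace \<phi> R \<Longrightarrow> energy (\<lambda>x. f x - f (x - s)) \<le> (\<epsilon> / 2 + C * (2 ^ R * s)\<^sup>2) * energy f"
    using Tspace_smooth[OF phi supp riesz half_gt_zero[OF \<epsilon>]] by blast
  define B where "B = sqrt (C / \<epsilon>) + 1"
  have B: "B > 0" unfolding B_def using C \<epsilon> by (simp add: add_nonneg_pos)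
  have "C / \<epsilon> = (sqrt (C / \<epsilon>))\<^sup>2" using C \<epsilon> by simp
  also have "\<dots> \<le> B\<^sup>2" unfolding B_def using C \<epsilon> by (intro power_mono) auto
  finally have CB: "C \<le> \<epsilon> * B\<^sup>2" using \<epsilon> by (simp add: field_simps)
  define c where "c = 2 * B * sqrt (2 / \<epsilon>)"
  have c: "c > 0" "c\<^sup>2 = 4 * B\<^sup>2 * (2 / \<epsilon>)" using B \<epsilon> by (simp_all add: c_def power_mult_distrib)
  have "(1 - \<epsilon>) * energy f \<le> integral {a..b} (\<lambda>w. (cmod (FT f w))\<^sup>2)"
    if f: "f \<in> Tspace \<phi> R" and K: "(c + 1) * 2 ^ R \<le> K" and ab: "a \<le> - (K - 1 / 2)" "K - 1 / 2 \<le> b" for R f K a b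
  proof -
    have fH: "f \<in> Hspace" by (rule Tspace_Hspace[OF phi supp f])
    have fs: "sq_int f" and fz: "\<And>x. x \<notin> {0..1} \<Longrightarrow> f x = 0" using fH by (auto simp: Hspace_def)
    define M where "M = (2 ^ R :: real)"
    have M: "M \<ge> 1" by (simp add: M_def)
    define T where "T = K - 1 / 2"
    have T: "c * M \<le> T" using K M by (simp add: T_def M_def[symmetric] algebra_simps)
    then have T0: "0 \<le> T" using c(1) M by (smt (verit) mult_nonneg_nonneg)
    have \<sigma>: "B * M > 0" using B M by simp
    have *: "energy f * (1 - (\<epsilon> / 2) / 2 - (C * M\<^sup>2) / (2 * (2 * pi * (B * M))\<^sup>2) - exp (- T\<^sup>2 / (4 * (B * M)\<^sup>2)))
      \<le> integral {a..b} (\<lambda>w. (cmod (FT f w))\<^sup>2)"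
    proof (rule FT_concentration[OF fs fz \<sigma>])
      show "energy (\<lambda>x. f x - f (x - s)) \<le> (\<epsilon> / 2 + C * M\<^sup>2 * s\<^sup>2) * energy f" for s
        using C(2)[OF f, of s] by (simp add: M_def power_mult_distrib mult.assoc)
      show "0 \<le> \<epsilon> / 2" "0 \<le> C * M\<^sup>2" using \<epsilon> C by auto
      show "0 \<le> T" by (rule T0)
      show "a \<le> - T" "T \<le> b" using ab by (simp_all add: T_def)
    qed
    have "(C * M\<^sup>2) / (2 * (2 * pi * (B * M))\<^sup>2) = C / (8 * pi\<^sup>2 * B\<^sup>2)"
      using M by (simp add: power_mult_distrib)
    also have "\<dots> \<le> \<epsilon> / 4"
    proof -
      have "2\<^sup>2 \<le> pi\<^sup>2" using pi_ge_two by (intro power_mono) auto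
      then have "1 * (\<epsilon> * B\<^sup>2) \<le> (2 * pi\<^sup>2) * (\<epsilon> * B\<^sup>2)" using \<epsilon> B by (intro mult_right_mono) auto
      then have "C \<le> (2 * pi\<^sup>2) * (\<epsilon> * B\<^sup>2)" using CB by linarith
      then show ?thesis using B by (simp add: divide_le_eq algebra_simps)
    qed
    finally have 1: "(C * M\<^sup>2) / (2 * (2 * pi * (B * M))\<^sup>2) \<le> \<epsilon> / 4" .
    have 2: "exp (- T\<^sup>2 / (4 * (B * M)\<^sup>2)) \<le> \<epsilon> / 2"
    proof -
      have "(c * M)\<^sup>2 \<le> T\<^sup>2" using T c(1) M by (intro power_mono) auto
      then have "2 / \<epsilon> * (4 * (B * M)\<^sup>2) \<le> T\<^sup>2"
        by (simp add: power_mult_distrib c(2) mult_ac)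
      moreover have "4 * (B * M)\<^sup>2 > 0" using B M by simp
      ultimately have "2 / \<epsilon> \<le> T\<^sup>2 / (4 * (B * M)\<^sup>2)" by (simp only: pos_le_divide_eq)
      also have "\<dots> \<le> exp (T\<^sup>2 / (4 * (B * M)\<^sup>2))" using exp_ge_add_one_self[of "T\<^sup>2 / (4 * (B * M)\<^sup>2)"] by linarith
      finally have "2 / \<epsilon> \<le> exp (T\<^sup>2 / (4 * (B * M)\<^sup>2))" .
      then have "inverse (exp (T\<^sup>2 / (4 * (B * M)\<^sup>2))) \<le> inverse (2 / \<epsilon>)" using \<epsilon> by (intro le_imp_inverse_le) auto
      then show ?thesis by (simp add: exp_minus)
    qed
    have "1 - \<epsilon> \<le> 1 - (\<epsilon> / 2) / 2 - (C * M\<^sup>2) / (2 * (2 * pi * (B * M))\<^sup>2) - exp (- T\<^sup>2 / (4 * (B * M)\<^sup>2))"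
      using 1 2 by linarith
    from mult_left_mono[OF this, of "energy f"] * show ?thesis by (simp add: mult.commute)
  qed
  then show thesis using that by blast
qed

lemma qform_upper:
  assumes D: "dense_scheme K \<delta> N w" and f: "f \<in> Hspace"
  shows "qform K N w f \<le> (1 + \<delta>)\<^sup>2 * energy f"
proof -
  have \<delta>: "\<delta> > 0" using D by (simp add: dense_scheme_def)
  have fs: "sq_int f" and fz: "\<And>x. x \<notin> {0..1} \<Longrightarrow> f x = 0" using f by (auto simp: Hspace_def)
  let ?Y = "integral {cell K N w 0..cell K N w N} (\<lambda>x. (cmod (FT f x))\<^sup>2)"
  have "qform K N w f \<le> (1 + \<delta>) * ?Y + (1 + 1 / \<delta>) * (\<delta>\<^sup>2 * energy f)"
    unfolding qform_eq[OF f] by (rule sampling_bounds(1)[OF D f \<delta>])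
  also have "\<dots> \<le> (1 + \<delta>) * energy f + (1 + 1 / \<delta>) * (\<delta>\<^sup>2 * energy f)"
    using FT_bessel[OF fs fz] \<delta> by (intro add_right_mono mult_left_mono) auto
  also have "\<dots> = (1 + \<delta>)\<^sup>2 * energy f" using \<delta> by (simp add: power2_eq_square field_simps)
  finally show ?thesis .
qed

lemma qform_lower:
  assumes D: "dense_scheme K \<delta> N w" and f: "f \<in> Hspace" and \<epsilon>: "0 < \<epsilon>" "\<epsilon> < 1 - \<delta>"
    and Y: "(1 - \<epsilon>) * energy f \<le> integral {cell K N w 0..cell K N w N} (\<lambda>x. (cmod (FT f x))\<^sup>2)"
  shows "(1 - \<delta> - \<epsilon>)\<^sup>2 * energy f \<le> qform K N w f"
proof -
  have \<delta>: "\<delta> > 0" using D by (simp add: dense_scheme_def)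
  define r where "r = 1 - \<delta> - \<epsilon>"
  have r: "r > 0" "1 - \<epsilon> = r + \<delta>" using \<epsilon> by (auto simp: r_def)
  have n: "energy f \<ge> 0" by simp
  have "(r + \<delta>)\<^sup>2 * energy f \<le> (r + \<delta>) * energy f"
  proof -
    have "(r + \<delta>) * (r + \<delta>) \<le> (r + \<delta>) * 1" using r \<delta> \<epsilon> by (intro mult_left_mono) auto
    then show ?thesis using n by (intro mult_right_mono) (auto simp: power2_eq_square)
  qed
  also have "\<dots> \<le> (1 + \<delta> / r) * qform K N w f + (1 + 1 / (\<delta> / r)) * (\<delta>\<^sup>2 * energy f)"
    using Y sampling_bounds(2)[OF D f, of "\<delta> / r"] r \<delta> unfolding qform_eq[OF f] by simp
  finally have "(r + \<delta>)\<^sup>2 * energy f * r \<le> ((1 + \<delta> / r) * qform K N w f + (1 + 1 / (\<delta> / r)) * (\<delta>\<^sup>2 * energy f)) * r"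
    using r by (intro mult_right_mono) auto
  also have "\<dots> = (r + \<delta>) * (qform K N w f + r * \<delta> * energy f)"
    using r \<delta> by (simp add: field_simps power2_eq_square)
  finally have "(r + \<delta>) * ((r + \<delta>) * r * energy f) \<le> (r + \<delta>) * (qform K N w f + r * \<delta> * energy f)"
    by (simp add: power2_eq_square mult_ac)
  then have "(r + \<delta>) * r * energy f \<le> qform K N w f + r * \<delta> * energy f"
    using r \<delta> by (subst (asm) mult_le_cancel_left_pos) auto
  then have "r\<^sup>2 * energy f \<le> qform K N w f" by (simp add: power2_eq_square algebra_simps)
  then show ?thesis by (simp only: r_def)
qed

theorem theorem5p3:
  fixes \<phi> :: "real \<Rightarrow> complex" and p :: nat
  assumes MRA: "is_MRA \<phi>"
    and p: "1 \<le> p"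
    and supp: "\<forall>x. x \<notin> {- real p + 1 .. real p} \<longrightarrow> \<phi> x = 0"
    and cases: "orthonormal_translates \<phi> \<or>
                (\<exists>c \<alpha>. \<alpha> > 1/2 \<and> (\<forall>w. cmod (FT \<phi> w) \<le> c * (1 + \<bar>w\<bar>) powr (- \<alpha>)))"
  shows "\<forall>\<epsilon>>0. \<exists>c0. \<forall>K \<delta> N w R. dense_scheme K \<delta> N w \<and> \<epsilon> < 1 - \<delta> \<and> K \<ge> c0 * 2 ^ R
           \<longrightarrow> Cconst K N w (Tspace \<phi> R) \<le> ereal ((1 + \<delta>) / (1 - \<delta> - \<epsilon>))"
proof (intro allI impI)
  fix \<epsilon> :: real assume \<epsilon>: "\<epsilon> > 0"
  have phi: "sq_int \<phi>" and riesz: "riesz_translates \<phi>" using MRA by (auto simp: is_MRA_def)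
  have sup: "\<And>x. x \<notin> {- real p + 1..real p} \<Longrightarrow> \<phi> x = 0" using supp by blast
  obtain c0 where c0: "\<And>R f K a b. \<lbrakk>f \<in> Tspace \<phi> R; c0 * 2 ^ R \<le> K; a \<le> - (K - 1 / 2); K - 1 / 2 \<le> b\<rbrakk> \<Longrightarrow>
     (1 - \<epsilon>) * energy f \<le> integral {a..b} (\<lambda>w. (cmod (FT f w))\<^sup>2)"
    using Tspace_concentration[OF phi sup riesz \<epsilon>] by blast
  have "Cconst K N w (Tspace \<phi> R) \<le> ereal ((1 + \<delta>) / (1 - \<delta> - \<epsilon>))"
    if D: "dense_scheme K \<delta> N w" and \<epsilon>\<delta>: "\<epsilon> < 1 - \<delta>" and K: "c0 * 2 ^ R \<le> K" for K \<delta> N w R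
  proof -
    define r where "r = 1 - \<delta> - \<epsilon>"
    have r: "r > 0" using \<epsilon>\<delta> by (simp add: r_def)
    have \<delta>: "\<delta> > 0" using D by (simp add: dense_scheme_def)
    have pos: "energy f > 0" if "L2norm f \<noteq> 0" for f
      using that by (metis L2norm_sq zero_less_power2)
    have C1: "ereal (r\<^sup>2) \<le> C1 K N w (Tspace \<phi> R)"
      unfolding C1_def
    proof (rule INF_greatest)
      fix f assume "f \<in> {f \<in> Tspace \<phi> R. L2norm f \<noteq> 0}"
      then have f: "f \<in> Tspace \<phi> R" and n: "energy f > 0" using pos by auto
      have "r\<^sup>2 * energy f \<le> qform K N w f"
        unfolding r_def
        by (rule qform_lower[OF D Tspace_Hspace[OF phi sup f] \<epsilon> \<epsilon>\<delta> c0[OF f K dense_scheme_cells(5,6)[OF D]]])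
      then show "ereal (r\<^sup>2) \<le> ereal (qform K N w f / (L2norm f)\<^sup>2)"
        unfolding L2norm_sq using n by (simp add: le_divide_eq)
    qed
    have C2: "C2 K N w \<le> ereal ((1 + \<delta>)\<^sup>2)"
      unfolding C2_def
    proof (rule SUP_least)
      fix f assume "f \<in> {f \<in> Hspace. L2norm f \<noteq> 0}"
      then have f: "f \<in> Hspace" and n: "energy f > 0" using pos by auto
      show "ereal (qform K N w f / (L2norm f)\<^sup>2) \<le> ereal ((1 + \<delta>)\<^sup>2)"
        unfolding L2norm_sq using qform_upper[OF D f] n by (simp add: divide_le_eq)
    qed
    have r2: "r\<^sup>2 > 0" using r by simp
    have q0: "(1 + \<delta>)\<^sup>2 / r\<^sup>2 \<ge> 0" by simp
    have "real_of_ereal (C2 K N w / C1 K N w (Tspace \<phi> R)) \<le> (1 + \<delta>)\<^sup>2 / r\<^sup>2"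
    proof (cases "C1 K N w (Tspace \<phi> R)")
      case (real x)
      then have x: "r\<^sup>2 \<le> x" using C1 by simp
      then have x0: "x > 0" using r2 by linarith
      show ?thesis
      proof (cases "C2 K N w")
        case (real y)
        then have "y \<le> (1 + \<delta>)\<^sup>2" using C2 by simp
        then have "y / x \<le> (1 + \<delta>)\<^sup>2 / x" using x0 by (intro divide_right_mono) auto
        also have "\<dots> \<le> (1 + \<delta>)\<^sup>2 / r\<^sup>2" by (intro divide_left_mono mult_pos_pos x x0 r2) simp
        finally show ?thesis using real \<open>C1 K N w (Tspace \<phi> R) = ereal x\<close> x0 by simp
      next
        case PInf
        then show ?thesis using C2 by simp
      next
        case MInf
        then show ?thesis using real x0 q0 by (simp add: divide_ereal_def)
      qed
    next
      case PInf
      then show ?thesis using q0 by (simp add: divide_ereal_def)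
    next
      case MInf
      then show ?thesis using C1 by simp
    qed
    then have "sqrt (real_of_ereal (C2 K N w / C1 K N w (Tspace \<phi> R))) \<le> sqrt ((1 + \<delta>)\<^sup>2 / r\<^sup>2)"
      by (rule real_sqrt_le_mono)
    also have "\<dots> = (1 + \<delta>) / r" using \<delta> r by (simp add: real_sqrt_divide)
    finally have "sqrt (real_of_ereal (C2 K N w / C1 K N w (Tspace \<phi> R))) \<le> (1 + \<delta>) / r" .
    moreover have "C1 K N w (Tspace \<phi> R) \<noteq> 0" using C1 r2 by auto
    moreover have "C2 K N w \<noteq> \<infinity>" using C2 by auto
    ultimately show ?thesis by (simp add: Cconst_def r_def)
  qed
  then show "\<exists>c0. \<forall>K \<delta> N w R. dense_scheme K \<delta> N w \<and> \<epsilon> < 1 - \<delta> \<and> K \<ge> c0 * 2 ^ R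
           \<longrightarrow> Cconst K N w (Tspace \<phi> R) \<le> ereal ((1 + \<delta>) / (1 - \<delta> - \<epsilon>))"
    by blast
qed

end
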